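(* Let $s,t\ge0$ and fix a cover of $\Pi^*_{s,t}$. For each $c\ge1$ let $x_c$ be the number of simplices of class $c$ in the cover. Then for every $t'$ with $0\le t'\le t$ and every $s'$ with $0\le s'\le s+t-t'$, $$\sum_{c=1}^{V(s,t)}\frac{c\cdot x_c}{(s'+2t')!}\,F(s,t,c,s',t',c)\ \ge\ \frac{Q(s,t,s',t')}{2^{t'}}.$$
   Context: $\Delta^d$ is the convex hull of the standard unit vectors of $\mathbb{R}^{d+1}$. $\Pi^*_{s,t}$ is the product of $s$ copies of $\Delta^1$ followed by $t$ copies of $\Delta^2$, of dimension $N=s+2t$, written in standard coordinates (one block $\mathbf x^i\in\Delta^{c_i}$ per factor); its vertices are the $0/1$ points. For a vertex $\mathbf v$, reduced coordinates with respect to $\mathbf v$ are obtained by deleting in each factor the coordinate at which $\mathbf v$ equals $1$. The class of an $N$-simplex with vertices among the vertices of $\Pi^*_{s,t}$ is $|\det[\mathbf 1\mid M_{\mathbf v}]|$, where the rows of $M_{\mathbf v}$ are the reduced coordinates of its vertices (this is $N!$ times its volume in reduced coordinates); a $k$-simplex whose vertices are vertices of a $k$-dimensional face $G$ of the simplotope has class computed in the same way inside the simplotope $G$. A cover of a polytope $P$ is a collection of full-dimensional simplices, each with vertices among the vertices of $P$, whose union is $P$. An exterior $j$-face of such a simplex $\alpha$ is a $j$-dimensional face of $\alpha$ whose $j+1$ vertices lie in a common $j$-dimensional face of the simplotope. A $\Pi_{s',t'}$ face of $\Pi^*_{s,t}$ is a face that is a product of exactly $s'$ segments and $t'$ triangles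 (other factors being points); $Q(s,t,s',t')$ is the number of such faces. $F(s,t,c,s',t',c')$ is the maximum, over all $N$-simplices $\alpha$ of class $c$ with vertices among the vertices of $\Pi^*_{s,t}$, of the number of exterior $(s'+2t')$-faces of $\alpha$ that lie in a $\Pi_{s',t'}$ face of $\Pi^*_{s,t}$ and have class $c'$. $V(s,t)$ is the largest possible class of a simplex in a cover of $\Pi^*_{s,t}$. *)

theory Defs
  imports "HOL-Analysis.Analysis" "HOL-Analysis.Finite_Function_Topology" "Jordan_Normal_Form.Determinant"
begin

text \<open>
  A point has blocks indexed by the natural numbers, and each block has coordinates indexed by the
  natural numbers; blocks and coordinates that do not occur are zero. The finitely supported
  functions form a real vector space, so \<^const>\<open>convex\<close> hulls, \<^const>\<open>face_of\<close>,
  \<^const>\<open>extreme_point_of\<close> and \<^const>\<open>affine_dependent\<close> below are those of the library.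
\<close>

type_synonym point = "nat \<Rightarrow>\<^sub>0 nat \<Rightarrow>\<^sub>0 real"

abbreviation coord :: "point \<Rightarrow> nat \<times> nat \<Rightarrow> real" where
  "coord x p \<equiv> Poly_Mapping.lookup (Poly_Mapping.lookup x (fst p)) (snd p)"

definition coord_simplex :: "nat set \<Rightarrow> (nat \<Rightarrow>\<^sub>0 real) set" where
  "coord_simplex J = convex hull ((\<lambda>j. Poly_Mapping.single j 1) ` J)"

definition std_simplex :: "nat \<Rightarrow> (nat \<Rightarrow>\<^sub>0 real) set" where
  "std_simplex d = coord_simplex {0..d}"

definition block_product :: "nat \<Rightarrow> (nat \<Rightarrow> (nat \<Rightarrow>\<^sub>0 real) set) \<Rightarrow> point set" where
  "block_product n E =
     {x. Poly_Mapping.keys x \<subseteq> {..<n} \<and> (\<forall>i<n. Poly_Mapping.lookup x i \<in> E i)}"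

definition simplotope :: "nat \<Rightarrow> nat \<Rightarrow> point set" where
  "simplotope s t = block_product (s + t) (\<lambda>i. std_simplex (if i < s then 1 else 2))"

definition vertices :: "point set \<Rightarrow> point set" where
  "vertices P = {v. v extreme_point_of P}"

text \<open>
  The library's \<^const>\<open>aff_dim\<close> is restricted to Euclidean spaces; this is the dimension of the
  linear space of directions of a set. It is only used for nonempty sets.
\<close>

definition affine_dimension :: "point set \<Rightarrow> nat" where
  "affine_dimension G = dim {x - y | x y. x \<in> G \<and> y \<in> G}"

definition dim_face :: "nat \<Rightarrow> nat \<Rightarrow> nat \<Rightarrow> point set \<Rightarrow> bool" where
  "dim_face s t j G \<longleftrightarrow> G \<noteq> {} \<and> G face_of simplotope s t \<and> affine_dimension G = j"

definition Pi_face :: "nat \<Rightarrow> nat \<Rightarrow> nat \<Rightarrow> nat \<Rightarrow> point set \<Rightarrow> bool" where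
  "Pi_face s t s' t' G \<longleftrightarrow> G face_of simplotope s t \<and>
     (\<exists>J. G = block_product (s + t) (\<lambda>i. coord_simplex (J i)) \<and>
          (\<forall>i<s + t. card (J i) \<in> {1, 2, 3}) \<and>
          card {i. i < s + t \<and> card (J i) = 2} = s' \<and>
          card {i. i < s + t \<and> card (J i) = 3} = t')"

definition Q :: "nat \<Rightarrow> nat \<Rightarrow> nat \<Rightarrow> nat \<Rightarrow> nat" where
  "Q s t s' t' = card {G. Pi_face s t s' t' G}"

text \<open>
  Here \<open>G\<close> is a nonempty face of the simplotope, itself a simplotope whose own standard coordinates
  are those that do not vanish identically on \<open>G\<close>. With respect to a vertex \<open>v\<close> of \<open>G\<close> the coordinate
  equal to 1 at \<open>v\<close> is dropped from each block, which also drops every factor of \<open>G\<close> that is a point.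
\<close>

definition reduced_coords :: "nat \<Rightarrow> nat \<Rightarrow> point set \<Rightarrow> point \<Rightarrow> (nat \<times> nat) list" where
  "reduced_coords s t G v =
     filter (\<lambda>p. (\<exists>x\<in>G. coord x p \<noteq> 0) \<and> coord v p \<noteq> 1) (List.product [0..<s + t] [0..<3])"

definition class_matrix ::
    "nat \<Rightarrow> nat \<Rightarrow> point set \<Rightarrow> point \<Rightarrow> point list \<Rightarrow> real mat" where
  "class_matrix s t G v vs =
     (let ps = reduced_coords s t G v
      in mat (length vs) (Suc (length ps))
           (\<lambda>(r, k). if k = 0 then 1 else coord (vs ! r) (ps ! (k - 1))))"

text \<open>
  A simplex is represented by its set of vertices. The absolute value of the determinant depends
  neither on the order in which these are listed nor on the vertex \<open>v\<close> of \<open>G\<close>: replacing \<open>v\<close> changes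
  coordinates within blocks by the relation that each block sums to 1. So both are chosen arbitrarily.
\<close>

definition simplex_class :: "nat \<Rightarrow> nat \<Rightarrow> point set \<Rightarrow> point set \<Rightarrow> real" where
  "simplex_class s t G S =
     (let v = (SOME v. v \<in> vertices G); vs = (SOME vs. set vs = S \<and> distinct vs)
      in \<bar>Determinant.det (class_matrix s t G v vs)\<bar>)"

definition full_simplex :: "nat \<Rightarrow> nat \<Rightarrow> point set \<Rightarrow> bool" where
  "full_simplex s t \<alpha> \<longleftrightarrow>
     \<alpha> \<subseteq> vertices (simplotope s t) \<and> card \<alpha> = s + 2 * t + 1 \<and> \<not> affine_dependent \<alpha>"

definition is_cover :: "nat \<Rightarrow> nat \<Rightarrow> point set set \<Rightarrow> bool" where
  "is_cover s t C \<longleftrightarrow>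
     (\<forall>\<alpha>\<in>C. full_simplex s t \<alpha>) \<and> (\<Union>\<alpha>\<in>C. convex hull \<alpha>) = simplotope s t"

definition num_of_class :: "nat \<Rightarrow> nat \<Rightarrow> point set set \<Rightarrow> nat \<Rightarrow> nat" where
  "num_of_class s t C c = card {\<alpha>\<in>C. simplex_class s t (simplotope s t) \<alpha> = real c}"

definition exterior_face :: "nat \<Rightarrow> nat \<Rightarrow> nat \<Rightarrow> point set \<Rightarrow> point set \<Rightarrow> bool" where
  "exterior_face s t j \<alpha> \<tau> \<longleftrightarrow>
     \<tau> \<subseteq> \<alpha> \<and> card \<tau> = j + 1 \<and> (\<exists>G. dim_face s t j G \<and> \<tau> \<subseteq> G)"

definition exterior_count ::
    "nat \<Rightarrow> nat \<Rightarrow> nat \<Rightarrow> nat \<Rightarrow> nat \<Rightarrow> point set \<Rightarrow> nat" where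
  "exterior_count s t s' t' c' \<alpha> =
     card {\<tau>. exterior_face s t (s' + 2 * t') \<alpha> \<tau> \<and>
              (\<exists>G. Pi_face s t s' t' G \<and> \<tau> \<subseteq> G \<and> simplex_class s t G \<tau> = real c')}"

text \<open>
  The suprema below are maxima of finite sets of natural numbers. If there is no simplex of class
  \<open>c\<close>, then \<open>F\<close> is the supremum of the empty set, which is 0.
\<close>

definition F :: "nat \<Rightarrow> nat \<Rightarrow> nat \<Rightarrow> nat \<Rightarrow> nat \<Rightarrow> nat \<Rightarrow> nat" where
  "F s t c s' t' c' =
     Sup {exterior_count s t s' t' c' \<alpha> | \<alpha>.
            full_simplex s t \<alpha> \<and> simplex_class s t (simplotope s t) \<alpha> = real c}"

definition V :: "nat \<Rightarrow> nat \<Rightarrow> nat" where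
  "V s t = Sup {c. \<exists>C \<alpha>. is_cover s t C \<and> \<alpha> \<in> C \<and>
                          simplex_class s t (simplotope s t) \<alpha> = real c}"

end

theory Submission
  imports Defs "HOL-Real_Asymp.Real_Asymp"
begin

text \<open>
  Fix a \<open>\<Pi>_{s',t'}\<close> face \<open>G\<close>, of dimension \<open>k = s' + 2 t'\<close>, and extend it to a flag of faces, each obtained from the
  next by setting one coordinate to zero. Let \<open>p\<close> be a point in the relative interior of \<open>G\<close>. The points
  of a curve that leaves \<open>p\<close> with a different order of tangency to each face of the flag are, arbitrarily
  close to \<open>p\<close>, contained in one simplex \<open>\<alpha>\<close> of the cover, and this forces \<open>\<alpha>\<close> to meet every face of the flag in
  a face of \<open>\<alpha>\<close> of the full dimension. As the vertices have coordinates 0 and 1, the class matrix of \<open>\<alpha>\<close> is then block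
  triangular with ones on the diagonal outside the block of \<open>\<tau> = \<alpha> \<inter> G\<close>, so \<open>\<tau>\<close> is an exterior face that
  contains \<open>p\<close> and has the same class as \<open>\<alpha>\<close>. Hence the exterior faces in \<open>G\<close> with the class of their
  simplex cover \<open>G\<close>, and the sum of their classes is at least \<open>k!\<close> times the reduced volume \<open>1 / 2^{t'}\<close>
  of \<open>G\<close>.

  Volumes are compared by counting points with coordinates in \<open>(1/N) \<int>\<close>: at most \<open>c * ((N + k) choose k)\<close> of
  them lie in a \<open>k\<close>-simplex of class \<open>c\<close>, because rounding down the \<open>N\<close>-fold barycentric coordinates leaves one of
  \<open>c\<close> possible remainders.
\<close>

subsection \<open>Lattice points in simplices\<close>

text \<open>Members of a cover may overlap, and a member may meet \<open>G\<close> in a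
  full-dimensional face whose class is a proper divisor of its own. \<open>F\<close> counts only
  faces with the class of the simplex itself, so it is not enough that the intersections with
  \<open>G\<close> cover \<open>G\<close>. The flag selects, at each interior point, a simplex for
  which the complementary factor of the determinant is 1: that factor is a product of diagonal
  entries, each 0 or 1, and it is not zero. The lattice count has to be right to leading order only.
  A simplex of class c receives at most about c * N^k / k! points, the interior of \<open>G\<close>
  contains about N^k / 2^t', and the k! of the theorem is what remains of the comparison. Ignoring
  the boundary of \<open>G\<close> costs a lower order term and guarantees positive coordinates,
  from which the curve can take mass without leaving the simplotope. A face \<open>\<tau>\<close>
  that touches every coordinate not vanishing on \<open>G\<close> determines \<open>G\<close>. Hence
  pairs of a simplex and its face found for different \<open>G\<close> are different, and the
  estimates for all \<open>G\<close> may be added.\<close>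

lemma card_unit_interval_affine_int:
  fixes d :: int and a :: real
  assumes "d \<noteq> 0"
  shows "finite {x::real. 0 \<le> x \<and> x < 1 \<and> x * of_int d + a \<in> \<int>}
       \<and> int (card {x::real. 0 \<le> x \<and> x < 1 \<and> x * of_int d + a \<in> \<int>}) \<le> \<bar>d\<bar>"
proof -
  have pos: "finite {x::real. 0 \<le> x \<and> x < 1 \<and> x * of_int d + a \<in> \<int>}
       \<and> int (card {x::real. 0 \<le> x \<and> x < 1 \<and> x * of_int d + a \<in> \<int>}) \<le> d" (is "finite ?X \<and> _")
    if "d > 0" for d :: int and a :: real
  proof -
    let ?Z = "{\<lceil>a\<rceil>..<\<lceil>a\<rceil> + d}"
    have sub: "?X \<subseteq> (\<lambda>z. (of_int z - a) / of_int d) ` ?Z"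
    proof
      fix x assume x: "x \<in> ?X"
      then obtain z where z: "x * of_int d + a = of_int z" by (auto elim: Ints_cases)
      have "0 \<le> x * of_int d" using x that by simp
      moreover have "x * of_int d < 1 * of_int d"
        using x that by (intro mult_strict_right_mono) auto
      ultimately have "z \<in> ?Z" using z by (simp add: ceiling_le_iff) linarith
      moreover have "x = (of_int z - a) / of_int d" using z that by (simp add: field_simps)
      ultimately show "x \<in> (\<lambda>z. (of_int z - a) / of_int d) ` ?Z" by blast
    qed
    have "card ?X \<le> card ?Z"
      using card_mono[OF _ sub] card_image_le[of ?Z "\<lambda>z. (of_int z - a) / of_int d"] by force
    then show ?thesis using that finite_subset[OF sub] by simp
  qed
  show ?thesis
  proof (cases "d > 0")
    case True
    then show ?thesis using pos[of d a] by simp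
  next
    case False
    have "(x * of_int d + a \<in> \<int>) = (x * of_int (- d) + (- a) \<in> \<int>)" for x
      using minus_in_Ints_iff[of "x * of_int d + a"] by simp
    then show ?thesis using pos[of "- d" "- a"] False assms by simp
  qed
qed

text \<open>Representatives in the half-open unit cube of the row vectors whose product with
  \<open>M\<close> is integral, modulo integer vectors. If the determinant is nonzero, this quotient
  is a group of order |det M|. The value 0 from \<open>K\<close> on lets the first \<open>K\<close>
  values determine \<open>f\<close> as a function.\<close>

definition frac_kernel :: "nat \<Rightarrow> int mat \<Rightarrow> (nat \<Rightarrow> real) set" where
  "frac_kernel K M = {f. (\<forall>r<K. 0 \<le> f r \<and> f r < 1) \<and> (\<forall>r\<ge>K. f r = 0) \<and>
     (\<forall>c<K. (\<Sum>r<K. f r * of_int (M $$ (r, c))) \<in> \<int>)}"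

text \<open>Adding an integer multiple of one column to another keeps integral row combinations
  integral. An inclusion suffices for an upper bound.\<close>

lemma frac_kernel_addcol:
  assumes M: "M \<in> carrier_mat K K" and "c < K" "c' < K"
  shows "frac_kernel K M \<subseteq> frac_kernel K (addcol a c c' M)"
proof
  fix f assume f: "f \<in> frac_kernel K M"
  have "(\<Sum>r<K. f r * of_int (addcol a c c' M $$ (r, j))) \<in> \<int>" if "j < K" for j
  proof -
    have "(\<Sum>r<K. f r * of_int (addcol a c c' M $$ (r, j))) =
      (if c = j then of_int a * (\<Sum>r<K. f r * of_int (M $$ (r, c'))) else 0)
        + (\<Sum>r<K. f r * of_int (M $$ (r, j)))"
      using M that by (auto simp: sum_distrib_left sum.distrib[symmetric] algebra_simps intro!: sum.cong)
    then show ?thesis using f that assms by (auto simp: frac_kernel_def)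
  qed
  then show "f \<in> frac_kernel K (addcol a c c' M)" using f by (auto simp: frac_kernel_def)
qed

text \<open>This is the index of a full-rank sublattice of the integer lattice. Euclid's algorithm on the columns
  reduces the last row to a single nonzero entry, which Laplace expansion then splits off.\<close>

lemma card_frac_kernel_le:
  assumes "M \<in> carrier_mat K K" "Determinant.det M \<noteq> 0"
  shows "finite (frac_kernel K M) \<and> int (card (frac_kernel K M)) \<le> \<bar>Determinant.det M\<bar>"
  using assms
proof (induction K arbitrary: M)
  case 0
  then have "frac_kernel 0 M = {\<lambda>_. 0}" by (auto simp: frac_kernel_def)
  moreover have "Determinant.det M = 1" using 0 by (simp add: Determinant.det_def)
  ultimately show ?case by simp
next
  case (Suc K)
  show ?case using Suc.prems
  proof (induction "nat (\<Sum>c<Suc K. \<bar>M $$ (K, c)\<bar>)" arbitrary: M rule: less_induct)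
    case less
    note M = less.prems(1)
    show ?case
    proof (cases "\<exists>c c'. c < Suc K \<and> c' < Suc K \<and> c \<noteq> c' \<and> M $$ (K, c) \<noteq> 0 \<and> M $$ (K, c') \<noteq> 0")
      case True
      then obtain c c' where c: "c < Suc K" "c' < Suc K" "c \<noteq> c'" "M $$ (K, c) \<noteq> 0"
        "M $$ (K, c') \<noteq> 0" "\<bar>M $$ (K, c')\<bar> \<le> \<bar>M $$ (K, c)\<bar>" by (metis linear)
      \<comment> \<open>The signs make \<open>a * M $$ (K, c')\<close> opposite to
        \<open>M $$ (K, c)\<close>, so that the larger absolute value drops by the smaller, nonzero
        one.\<close>
      define a where "a = - (sgn (M $$ (K, c)) * sgn (M $$ (K, c')))"
      let ?M = "addcol a c c' M"
      have M': "?M \<in> carrier_mat (Suc K) (Suc K)" using M by auto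
      have d: "Determinant.det ?M = Determinant.det M" using det_addcol c M by blast
      have entry: "?M $$ (K, j) = (if c = j then a * M $$ (K, c') + M $$ (K, c) else M $$ (K, j))"
        if "j < Suc K" for j using M that by auto
      have "\<bar>a * M $$ (K, c') + M $$ (K, c)\<bar> < \<bar>M $$ (K, c)\<bar>"
        using c(4-6) unfolding a_def by (auto simp: sgn_if)
      then have "(\<Sum>j<Suc K. \<bar>?M $$ (K, j)\<bar>) < (\<Sum>j<Suc K. \<bar>M $$ (K, j)\<bar>)"
        using c(1) entry by (intro sum_strict_mono_ex1) (auto intro!: bexI[of _ c])
      then have "nat (\<Sum>j<Suc K. \<bar>?M $$ (K, j)\<bar>) < nat (\<Sum>j<Suc K. \<bar>M $$ (K, j)\<bar>)"
        by (subst nat_mono_iff) (meson abs_ge_zero order_le_less_trans sum_nonneg)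
      then have IH: "finite (frac_kernel (Suc K) ?M)"
        "int (card (frac_kernel (Suc K) ?M)) \<le> \<bar>Determinant.det M\<bar>"
        using less.hyps[OF _ M'] less.prems(2) d by auto
      have sub: "frac_kernel (Suc K) M \<subseteq> frac_kernel (Suc K) ?M"
        using frac_kernel_addcol[OF M c(1,2)] .
      show ?thesis using IH card_mono[OF IH(1) sub] finite_subset[OF sub IH(1)] by linarith
    next
      case False
      have lap: "Determinant.det M = (\<Sum>j<Suc K. M $$ (K, j) * cofactor M K j)"
        by (rule laplace_expansion_row[OF M]) simp
      obtain c where c: "c < Suc K" "M $$ (K, c) \<noteq> 0"
        using lap less.prems(2) by (metis (no_types, lifting) lessThan_iff mult_eq_0_iff sum.neutral)
      have z: "M $$ (K, j) = 0" if "j < Suc K" "j \<noteq> c" for j using False c that by blast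
      define d where "d = M $$ (K, c)"
      define M1 where "M1 = mat_delete M K c"
      have M1: "M1 \<in> carrier_mat K K" using M unfolding M1_def
        by (metis diff_Suc_1 mat_delete_carrier)
      have "Determinant.det M = (\<Sum>j<Suc K. if j = c then d * cofactor M K c else 0)"
        unfolding lap using z by (intro sum.cong) (auto simp: d_def)
      then have "Determinant.det M = d * cofactor M K c" using c by (simp only: sum.delta) auto
      then have det: "\<bar>Determinant.det M\<bar> = \<bar>d\<bar> * \<bar>Determinant.det M1\<bar>"
        by (simp add: cofactor_def M1_def abs_mult power_abs)
      have d1: "Determinant.det M1 \<noteq> 0" using less.prems(2) det by auto
      have IH: "finite (frac_kernel K M1)" "int (card (frac_kernel K M1)) \<le> \<bar>Determinant.det M1\<bar>"
        using Suc.IH[OF M1] d1 by blast+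
      \<comment> \<open>\<open>X g\<close> holds the possible last coordinates once the others are
        fixed as \<open>g\<close>. Only column \<open>c\<close> has a nonzero last entry, so
        integrality constrains the last coordinate in that column alone, and all other columns
        constrain \<open>g\<close> through the minor \<open>M1\<close>.\<close>
      define X where "X g = {x::real. 0 \<le> x \<and> x < 1 \<and>
          x * of_int d + (\<Sum>r<K. g r * of_int (M $$ (r, c))) \<in> \<int>}" for g :: "nat \<Rightarrow> real"
      have X: "finite (X g)" "int (card (X g)) \<le> \<bar>d\<bar>" for g
        using card_unit_interval_affine_int[of d] c unfolding X_def d_def by blast+
      have sub: "frac_kernel (Suc K) M \<subseteq> (\<Union>g\<in>frac_kernel K M1. (\<lambda>x. g(K := x)) ` X g)"
      proof
        fix f assume f: "f \<in> frac_kernel (Suc K) M"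
        define g where "g = f(K := 0)"
        have "(\<Sum>r<K. g r * of_int (M1 $$ (r, j))) \<in> \<int>" if "j < K" for j
        proof -
          let ?j = "if j < c then j else Suc j"
          have j: "?j < Suc K" "?j \<noteq> c" using that by auto
          have "(\<Sum>r<K. g r * of_int (M1 $$ (r, j))) = (\<Sum>r<K. f r * of_int (M $$ (r, ?j)))"
            using that M by (intro sum.cong) (auto simp: g_def M1_def mat_delete_def)
          also have "\<dots> = (\<Sum>r<Suc K. f r * of_int (M $$ (r, ?j)))" using z[OF j] by simp
          finally show ?thesis using f j by (simp add: frac_kernel_def)
        qed
        then have "g \<in> frac_kernel K M1" using f by (auto simp: frac_kernel_def g_def)
        moreover have "f K \<in> X g"
        proof -
          have "(\<Sum>r<Suc K. f r * of_int (M $$ (r, c))) =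
              f K * of_int d + (\<Sum>r<K. g r * of_int (M $$ (r, c)))"
            by (simp add: g_def d_def)
          then show ?thesis using f c(1) unfolding X_def frac_kernel_def by (auto simp del: sum.lessThan_Suc)
        qed
        moreover have "f = g(K := f K)" by (auto simp: g_def)
        ultimately show "f \<in> (\<Union>g\<in>frac_kernel K M1. (\<lambda>x. g(K := x)) ` X g)" by blast
      qed
      have fin: "finite (\<Union>g\<in>frac_kernel K M1. (\<lambda>x. g(K := x)) ` X g)" using IH(1) X(1) by auto
      have "int (card (frac_kernel (Suc K) M)) \<le> int (card (\<Union>g\<in>frac_kernel K M1. (\<lambda>x. g(K := x)) ` X g))"
        using card_mono[OF fin sub] by simp
      also have "\<dots> \<le> int (\<Sum>g\<in>frac_kernel K M1. card ((\<lambda>x. g(K := x)) ` X g))"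
        using card_UN_le[OF IH(1)] by (simp only: of_nat_le_iff)
      also have "\<dots> \<le> (\<Sum>g\<in>frac_kernel K M1. \<bar>d\<bar>)"
        unfolding of_nat_sum
      proof (rule sum_mono)
        fix g show "int (card ((\<lambda>x. g(K := x)) ` X g)) \<le> \<bar>d\<bar>"
          using card_image_le[OF X(1), of "\<lambda>x. g(K := x)" g] X(2)[of g] by linarith
      qed
      also have "\<dots> \<le> \<bar>Determinant.det M\<bar>"
        using IH(2) by (simp add: det mult.commute mult_left_mono)
      finally show ?thesis using finite_subset[OF sub fin] by simp
    qed
  qed
qed

lemma card_lattice_points_simplex_le:
  fixes n :: nat
  assumes M: "M \<in> carrier_mat (Suc k) (Suc k)" and "Determinant.det M \<noteq> 0"
  defines "W \<equiv> {\<mu>. (\<forall>r\<le>k. 0 \<le> \<mu> r) \<and> (\<forall>r>k. \<mu> r = 0) \<and> (\<Sum>r\<le>k. \<mu> r) = real n \<and>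
      (\<forall>c\<le>k. (\<Sum>r\<le>k. \<mu> r * of_int (M $$ (r, c))) \<in> \<int>)}"
  shows "finite W" "int (card W) \<le> \<bar>Determinant.det M\<bar> * int ((n + k) choose k)"
proof -
  let ?S = "frac_kernel (Suc k) M"
  have S: "finite ?S" "int (card ?S) \<le> \<bar>Determinant.det M\<bar>"
    using card_frac_kernel_le[OF M] assms by auto
  \<comment> \<open>The integer parts of \<open>\<mu>\<close> add up to \<open>n\<close> minus the
    sum of the remainders, so the remainder vector \<open>f\<close> already fixes their total.
    Remainders are nonnegative, hence the total is at most \<open>n\<close> and at most
    \<open>(n + k) choose k\<close> lists of integer parts belong to each \<open>f\<close>.\<close>
  define N where "N f = nat \<lfloor>real n - (\<Sum>r\<le>k. f r)\<rfloor>" for f :: "nat \<Rightarrow> real"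
  define L where "L m = {l::nat list. size l = Suc k \<and> sum_list l = m}" for m
  have card_L: "card (L m) = (m + k) choose k" for m
    using card_length_sum_list[of "Suc k" m] binomial_symmetric[of m "m + k"] by (simp add: L_def)
  have fin_L: "finite (L m)" for m using card_L[of m] card_ge_0_finite[of "L m"] by simp
  define h where "h \<mu> = ((\<lambda>r. frac (\<mu> r)), map (\<lambda>r. nat \<lfloor>\<mu> r\<rfloor>) [0..<Suc k])" for \<mu> :: "nat \<Rightarrow> real"
  have "inj_on h W"
  proof (rule inj_onI)
    fix \<mu> \<nu> assume W: "\<mu> \<in> W" "\<nu> \<in> W" and eq: "h \<mu> = h \<nu>"
    show "\<mu> = \<nu>"
    proof
      fix r
      show "\<mu> r = \<nu> r"
      proof (cases "r \<le> k")
        case True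
        have "fst (h \<mu>) = fst (h \<nu>)" using eq by simp
        then have fr: "frac (\<mu> r) = frac (\<nu> r)" by (simp add: h_def fun_eq_iff)
        have "snd (h \<mu>) ! r = snd (h \<nu>) ! r" using eq by simp
        then have "nat \<lfloor>\<mu> r\<rfloor> = nat \<lfloor>\<nu> r\<rfloor>" using True by (simp add: h_def del: upt_Suc)
        moreover have "0 \<le> \<mu> r" "0 \<le> \<nu> r" using W True by (auto simp: W_def)
        ultimately have "\<lfloor>\<mu> r\<rfloor> = \<lfloor>\<nu> r\<rfloor>" by (simp add: eq_nat_nat_iff)
        then show ?thesis using fr by (simp add: frac_def)
      qed (use W in \<open>auto simp: W_def\<close>)
    qed
  qed
  moreover have "h ` W \<subseteq> (SIGMA f:?S. L (N f))"
  proof (rule image_subsetI)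
    fix \<mu> assume \<mu>: "\<mu> \<in> W"
    let ?f = "\<lambda>r. frac (\<mu> r)"
    have dec: "\<mu> r = of_int \<lfloor>\<mu> r\<rfloor> + ?f r" for r by (simp add: frac_def)
    have "(\<Sum>r<Suc k. ?f r * of_int (M $$ (r, c))) \<in> \<int>" if "c < Suc k" for c
    proof -
      have "(\<Sum>r<Suc k. ?f r * of_int (M $$ (r, c))) =
        (\<Sum>r\<le>k. \<mu> r * of_int (M $$ (r, c))) - (\<Sum>r\<le>k. of_int \<lfloor>\<mu> r\<rfloor> * of_int (M $$ (r, c)))"
        unfolding lessThan_Suc_atMost by (simp add: frac_def sum_subtractf algebra_simps)
      moreover have "(\<Sum>r\<le>k. of_int \<lfloor>\<mu> r\<rfloor> * of_int (M $$ (r, c))) \<in> (\<int>::real set)" by auto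
      ultimately show ?thesis using \<mu> that unfolding W_def by (auto simp del: sum.lessThan_Suc)
    qed
    then have "?f \<in> ?S" using \<mu> unfolding frac_kernel_def W_def by (auto simp: frac_lt_1 simp del: sum.lessThan_Suc)
    moreover have "sum_list (map (\<lambda>r. nat \<lfloor>\<mu> r\<rfloor>) [0..<Suc k]) = N ?f"
    proof -
      have "real n - (\<Sum>r\<le>k. ?f r) = (\<Sum>r\<le>k. of_int \<lfloor>\<mu> r\<rfloor>)"
        using \<mu> unfolding W_def by (simp add: frac_def sum_subtractf)
      also have "\<dots> = real (\<Sum>r\<le>k. nat \<lfloor>\<mu> r\<rfloor>)" unfolding of_nat_sum using \<mu>
        by (intro sum.cong) (auto simp: W_def)
      finally have "N ?f = (\<Sum>r\<le>k. nat \<lfloor>\<mu> r\<rfloor>)" unfolding N_def by (simp only: floor_of_nat nat_int)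
      then show ?thesis unfolding interv_sum_list_conv_sum_set_nat set_upt atLeast0LessThan
          lessThan_Suc_atMost by simp
    qed
    ultimately show "h \<mu> \<in> (SIGMA f:?S. L (N f))" unfolding h_def L_def by simp
  qed
  moreover have fin: "finite (SIGMA f:?S. L (N f))" using S fin_L by auto
  ultimately have cW: "card W \<le> card (SIGMA f:?S. L (N f))" and "finite W"
    by (auto intro: card_inj_on_le simp: inj_on_finite)
  show "finite W" by fact
  have "card (SIGMA f:?S. L (N f)) = (\<Sum>f\<in>?S. (N f + k) choose k)"
    using S(1) fin_L by (simp add: card_L)
  also have "\<dots> \<le> (\<Sum>f\<in>?S. (n + k) choose k)"
  proof (rule sum_mono, rule binomial_right_mono)
    fix f assume "f \<in> ?S"
    then have "0 \<le> (\<Sum>r\<le>k. f r)" by (intro sum_nonneg) (auto simp: frac_kernel_def)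
    then show "N f + k \<le> n + k" unfolding N_def by linarith
  qed
  finally have "int (card W) \<le> int (card ?S) * int ((n + k) choose k)"
    using cW by (simp flip: of_nat_mult)
  also have "\<dots> \<le> \<bar>Determinant.det M\<bar> * int ((n + k) choose k)"
    using S(2) by (intro mult_right_mono) auto
  finally show "int (card W) \<le> \<bar>Determinant.det M\<bar> * int ((n + k) choose k)" .
qed

subsection \<open>Determinants\<close>

definition eval_mat :: "'a list \<Rightarrow> ('a \<Rightarrow> real) list \<Rightarrow> real mat" where
  "eval_mat vs fs = mat (length vs) (length fs) (\<lambda>(r, c). (fs ! c) (vs ! r))"

lemma eval_mat_carrier [simp]:
  "eval_mat vs fs \<in> carrier_mat (length vs) (length fs)"
  by (simp add: eval_mat_def)

lemma eval_mat_index [simp]: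
  "r < length vs \<Longrightarrow> c < length fs \<Longrightarrow> eval_mat vs fs $$ (r, c) = (fs ! c) (vs ! r)"
  by (simp add: eval_mat_def)

text \<open>The identity is required on \<open>S\<close> only: a deleted coordinate is an integer
  combination of the reduced ones and 1 only where its block sums to 1.\<close>

definition int_comb :: "'a set \<Rightarrow> ('a \<Rightarrow> real) list \<Rightarrow> ('a \<Rightarrow> real) \<Rightarrow> bool" where
  "int_comb S fs g \<longleftrightarrow>
     (\<exists>T::nat \<Rightarrow> int. \<forall>x\<in>S. g x = (\<Sum>c = 0..<length fs. (fs ! c) x * of_int (T c)))"

lemma int_comb_member:
  assumes "f \<in> set fs" shows "int_comb S fs f"
proof -
  obtain i where i: "i < length fs" "fs ! i = f" using assms by (auto simp: in_set_conv_nth)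
  have "f x = (\<Sum>c = 0..<length fs. (fs ! c) x * of_int (if c = i then 1 else 0))" for x
  proof -
    have "(\<Sum>c = 0..<length fs. (fs ! c) x * of_int (if c = i then 1 else 0))
        = (\<Sum>c = 0..<length fs. if c = i then (fs ! c) x else 0)" by (intro sum.cong) auto
    then show ?thesis using i by (simp add: sum.delta)
  qed
  then show ?thesis unfolding int_comb_def by (intro exI[of _ "\<lambda>c. if c = i then 1 else 0"]) simp
qed

lemma int_comb_diff:
  assumes "int_comb S fs g" "int_comb S fs h"
  shows "int_comb S fs (\<lambda>x. g x - h x)"
proof -
  obtain T U :: "nat \<Rightarrow> int" where
    "\<forall>x\<in>S. g x = (\<Sum>c = 0..<length fs. (fs ! c) x * of_int (T c))"
    "\<forall>x\<in>S. h x = (\<Sum>c = 0..<length fs. (fs ! c) x * of_int (U c))"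
    using assms unfolding int_comb_def by blast
  then have "\<forall>x\<in>S. g x - h x = (\<Sum>c = 0..<length fs. (fs ! c) x * of_int (T c - U c))"
    by (simp add: algebra_simps sum_subtractf)
  then show ?thesis unfolding int_comb_def by (rule exI[of _ "\<lambda>c. T c - U c"])
qed

lemma int_comb_sum:
  assumes "finite I" "\<And>i. i \<in> I \<Longrightarrow> int_comb S fs (g i)"
  shows "int_comb S fs (\<lambda>x. \<Sum>i\<in>I. g i x)"
proof -
  have "\<forall>i\<in>I. \<exists>T::nat \<Rightarrow> int. \<forall>x\<in>S. g i x = (\<Sum>c = 0..<length fs. (fs ! c) x * of_int (T c))"
    using assms(2) unfolding int_comb_def by blast
  then obtain T :: "_ \<Rightarrow> nat \<Rightarrow> int" where
    T: "\<forall>i\<in>I. \<forall>x\<in>S. g i x = (\<Sum>c = 0..<length fs. (fs ! c) x * of_int (T i c))"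
    by metis
  have "\<forall>x\<in>S. (\<Sum>i\<in>I. g i x) = (\<Sum>c = 0..<length fs. (fs ! c) x * of_int (\<Sum>i\<in>I. T i c))"
  proof
    fix x assume "x \<in> S"
    then have "(\<Sum>i\<in>I. g i x) = (\<Sum>i\<in>I. \<Sum>c = 0..<length fs. (fs ! c) x * of_int (T i c))"
      using T by simp
    also have "\<dots> = (\<Sum>c = 0..<length fs. \<Sum>i\<in>I. (fs ! c) x * of_int (T i c))" by (rule sum.swap)
    finally show "(\<Sum>i\<in>I. g i x) = (\<Sum>c = 0..<length fs. (fs ! c) x * of_int (\<Sum>i\<in>I. T i c))"
      by (simp add: sum_distrib_left)
  qed
  then show ?thesis unfolding int_comb_def by (rule exI[of _ "\<lambda>c. \<Sum>i\<in>I. T i c"])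
qed

lemma int_comb_cong:
  assumes "int_comb S fs g" "\<And>x. x \<in> S \<Longrightarrow> g x = h x"
  shows "int_comb S fs h"
  using assms unfolding int_comb_def by metis

text \<open>The integer coefficients form a matrix that multiplies the evaluation matrix from the
  right; its determinant is the factor \<open>t\<close>.\<close>

lemma det_eval_mat_int_comb:
  assumes len: "length fs = length vs" "length gs = length vs"
    and S: "set vs \<subseteq> S" and g: "\<And>g. g \<in> set gs \<Longrightarrow> int_comb S fs g"
  shows "\<exists>t::int. Determinant.det (eval_mat vs gs) = Determinant.det (eval_mat vs fs) * of_int t"
proof -
  let ?n = "length vs"
  have "\<forall>j<?n. \<exists>T::nat \<Rightarrow> int. \<forall>x\<in>S. (gs ! j) x = (\<Sum>c = 0..<?n. (fs ! c) x * of_int (T c))"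
    using g len unfolding int_comb_def by (metis nth_mem)
  then obtain T :: "nat \<Rightarrow> nat \<Rightarrow> int" where
    T: "\<forall>j<?n. \<forall>x\<in>S. (gs ! j) x = (\<Sum>c = 0..<?n. (fs ! c) x * of_int (T j c))"
    by metis
  define M where "M = mat ?n ?n (\<lambda>(c, j). T j c)"
  have M: "M \<in> carrier_mat ?n ?n" by (simp add: M_def)
  have f: "eval_mat vs fs \<in> carrier_mat ?n ?n" using eval_mat_carrier[of vs fs] len by simp
  have "eval_mat vs gs = eval_mat vs fs * map_mat of_int M"
  proof (rule eq_matI)
    fix r j assume "r < dim_row (eval_mat vs fs * map_mat of_int M)"
      "j < dim_col (eval_mat vs fs * map_mat of_int M)"
    then have rj: "r < ?n" "j < ?n" using f M by auto
    then have "(eval_mat vs fs * map_mat of_int M) $$ (r, j)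
       = (\<Sum>c = 0..<?n. (fs ! c) (vs ! r) * of_int (T j c))"
      using f M len by (auto simp: scalar_prod_def M_def intro!: sum.cong)
    also have "\<dots> = (gs ! j) (vs ! r)" using T rj S by (simp add: subset_iff)
    finally show "eval_mat vs gs $$ (r, j) = (eval_mat vs fs * map_mat of_int M) $$ (r, j)"
      using rj len by simp
  qed (use len M in \<open>auto simp: eval_mat_def\<close>)
  then have "Determinant.det (eval_mat vs gs)
      = Determinant.det (eval_mat vs fs) * of_int (Determinant.det M)"
    using det_mult[OF f, of "map_mat of_int M"] M by (simp add: of_int_hom.hom_det)
  then show ?thesis by blast
qed

text \<open>Each determinant is an integer multiple of the other. If they are nonzero, the two
  multipliers have product 1, so both are 1 or both are -1.\<close>

lemma abs_det_eval_mat_eq: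
  assumes len: "length fs = length vs" "length gs = length vs" and S: "set vs \<subseteq> S"
    and "\<And>g. g \<in> set gs \<Longrightarrow> int_comb S fs g" "\<And>f. f \<in> set fs \<Longrightarrow> int_comb S gs f"
  shows "\<bar>Determinant.det (eval_mat vs gs)\<bar> = \<bar>Determinant.det (eval_mat vs fs)\<bar>"
proof -
  let ?F = "Determinant.det (eval_mat vs fs)" and ?G = "Determinant.det (eval_mat vs gs)"
  obtain t u :: int where tu: "?G = ?F * of_int t" "?F = ?G * of_int u"
    using det_eval_mat_int_comb[OF len S] det_eval_mat_int_comb[OF len(2,1) S] assms(4,5) by metis
  show ?thesis
  proof (cases "?F = 0")
    case False
    have "?F * of_int (t * u) = ?F" using tu by (metis mult.assoc of_int_mult)
    then have "t * u = 1" using False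
      by (metis mult.right_neutral mult_left_cancel of_int_1 of_int_eq_iff)
    then have "\<bar>t\<bar> = 1" by (metis abs_zmult_eq_1 abs_1)
    then have "\<bar>real_of_int t\<bar> = 1" by (metis of_int_1 of_int_abs)
    then show ?thesis using tu(1) by (simp add: abs_mult)
  qed (use tu(1) in simp)
qed

lemma abs_det_eval_mat_reorder:
  assumes "distinct vs" "distinct ws" "set vs = set ws" and len: "length fs = length vs"
  shows "\<bar>Determinant.det (eval_mat vs fs)\<bar> = \<bar>Determinant.det (eval_mat ws fs)\<bar>"
proof -
  have "mset vs = mset ws" using assms set_eq_iff_mset_eq_distinct by blast
  then obtain p where p: "p permutes {..<length ws}" "permute_list p ws = vs"
    using mset_eq_permutation by blast
  have lw: "length ws = length vs" using p(2) by auto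
  have ws: "eval_mat ws fs \<in> carrier_mat (length vs) (length vs)"
    using eval_mat_carrier[of ws fs] len lw by simp
  have "p r < length ws" "vs ! r = ws ! p r" if "r < length vs" for r
    using permutes_in_image[OF p(1), of r] permute_list_nth[OF p(1), of r] p(2) that lw by auto
  then have "eval_mat vs fs = mat (length vs) (length vs) (\<lambda>(i, j). eval_mat ws fs $$ (p i, j))"
    using lw len by (intro eq_matI) (simp_all add: eval_mat_def)
  then have "Determinant.det (eval_mat vs fs) = signof p * Determinant.det (eval_mat ws fs)"
    using det_permute_rows[OF ws, of p] p(1) lw by (simp add: lessThan_atLeast0)
  then show ?thesis by (simp add: abs_mult sign_def)
qed

lemma det_eval_mat_int:
  assumes "length fs = length vs" and "\<And>f v. f \<in> set fs \<Longrightarrow> v \<in> set vs \<Longrightarrow> f v \<in> \<int>"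
  obtains M where "M \<in> carrier_mat (length vs) (length vs)" "eval_mat vs fs = map_mat of_int M"
    "Determinant.det (eval_mat vs fs) = of_int (Determinant.det M)"
proof -
  define M where "M = mat (length vs) (length vs) (\<lambda>(r, c). \<lfloor>(fs ! c) (vs ! r)\<rfloor>)"
  have "eval_mat vs fs = map_mat of_int M"
    using assms by (intro eq_matI) (auto simp: eval_mat_def M_def)
  moreover have "M \<in> carrier_mat (length vs) (length vs)" by (simp add: M_def)
  ultimately show ?thesis using that by (metis of_int_hom.hom_det)
qed

text \<open>Divided by e^j, where j is the lowest order not yet excluded, the polynomial tends to
  \<open>b j\<close> while the bound e^(h - j) tends to 0. Values of e accumulating at 0 are enough;
  a simplex of the cover is only known to contain the curve for such values.\<close>

lemma coeffs_zero_if_frequently_small: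
  fixes b :: "nat \<Rightarrow> real"
  assumes freq: "\<exists>\<^sub>F e in at_right 0. \<bar>\<Sum>a = 0..<n. b a * e ^ a\<bar> \<le> e ^ h"
    and "j < h" "j < n"
  shows "b j = 0"
  using assms(2,3)
proof (induction j rule: less_induct)
  case (less j)
  show ?case
  proof (rule ccontr)
    assume bj: "b j \<noteq> 0"
    define q where "q e = (\<Sum>a = j..<n. b a * e ^ (a - j))" for e :: real
    have q: "(\<Sum>a = 0..<n. b a * e ^ a) = e ^ j * q e" for e
    proof -
      have "(\<Sum>a = 0..<n. b a * e ^ a) = (\<Sum>a = j..<n. b a * e ^ a)"
        using less by (intro sum.mono_neutral_right) auto
      also have "\<dots> = e ^ j * q e" unfolding q_def sum_distrib_left
      proof (intro sum.cong refl)
        fix a assume "a \<in> {j..<n}"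
        then have "e ^ a = e ^ j * e ^ (a - j)" by (simp flip: power_add)
        then show "b a * e ^ a = e ^ j * (b a * e ^ (a - j))" by simp
      qed
      finally show ?thesis .
    qed
    have "(q \<longlongrightarrow> (\<Sum>a = j..<n. b a * 0 ^ (a - j))) (at_right 0)"
      unfolding q_def by (intro tendsto_intros)
    moreover have "(\<Sum>a = j..<n. b a * 0 ^ (a - j)) = (\<Sum>a = j..<n. if a = j then b a else 0)"
      by (intro sum.cong) auto
    ultimately have "(q \<longlongrightarrow> b j) (at_right 0)" using less.prems by (simp add: sum.delta)
    then have "((\<lambda>e. \<bar>q e\<bar> - e ^ (h - j)) \<longlongrightarrow> \<bar>b j\<bar> - 0 ^ (h - j)) (at_right 0)"
      by (intro tendsto_intros)
    moreover have "\<bar>b j\<bar> - 0 ^ (h - j) > 0" using bj less.prems by (simp add: power_0_left)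
    ultimately have "\<forall>\<^sub>F e in at_right 0. \<bar>q e\<bar> - e ^ (h - j) > 0"
      by (rule order_tendstoD(1))
    moreover have "\<forall>\<^sub>F e::real in at_right 0. 0 < e" by (rule eventually_at_right_less)
    ultimately have "\<forall>\<^sub>F e in at_right 0. \<not> \<bar>\<Sum>a = 0..<n. b a * e ^ a\<bar> \<le> e ^ h"
    proof eventually_elim
      case (elim e)
      have "e ^ h = e ^ j * e ^ (h - j)" using less.prems by (simp flip: power_add)
      then show ?case using elim by (simp add: q abs_mult)
    qed
    then show False using freq by (simp add: frequently_def)
  qed
qed

text \<open>The determinant is that of the upper left block times the diagonal entries from
  \<open>K\<close> on. These are 0 or 1, so a nonzero determinant makes all of them 1. This is what
  gives a simplex and its face the same class.\<close>

lemma det_block_lower_unitriangular: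
  fixes A :: "real mat"
  assumes A: "A \<in> carrier_mat n n" and "K \<le> n"
    and z: "\<And>b c. K \<le> c \<Longrightarrow> c < n \<Longrightarrow> b < c \<Longrightarrow> A $$ (b, c) = 0"
    and zo: "\<And>c. K \<le> c \<Longrightarrow> c < n \<Longrightarrow> A $$ (c, c) \<in> {0, 1}"
    and nz: "Determinant.det A \<noteq> 0"
  shows "\<And>c. K \<le> c \<Longrightarrow> c < n \<Longrightarrow> A $$ (c, c) = 1"
    and "Determinant.det A = Determinant.det (mat K K (\<lambda>(b, c). A $$ (b, c)))"
proof -
  define m where "m = n - K"
  have n: "n = K + m" using assms(2) by (simp add: m_def)
  let ?L = "mat K K (\<lambda>(b, c). A $$ (b, c))" and ?R = "mat m m (\<lambda>(b, c). A $$ (K + b, K + c))"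
  let ?B = "mat m K (\<lambda>(b, c). A $$ (K + b, c))"
  have blk: "A = four_block_mat ?L (0\<^sub>m K m) ?B ?R"
    using A n z by (intro eq_matI) auto
  have "Determinant.det A = Determinant.det ?L * Determinant.det ?R"
    by (subst blk, rule det_four_block_mat_upper_right_zero) auto
  moreover have "Determinant.det ?R = prod_list (diag_mat ?R)"
    using z n by (intro det_lower_triangular[of m]) auto
  moreover have diag: "diag_mat ?R = map (\<lambda>i. A $$ (K + i, K + i)) [0..<m]"
    by (auto simp: diag_mat_def)
  ultimately have d: "Determinant.det A
      = Determinant.det ?L * prod_list (map (\<lambda>i. A $$ (K + i, K + i)) [0..<m])" by simp
  then have "0 \<notin> set (map (\<lambda>i. A $$ (K + i, K + i)) [0..<m])" using nz by (auto simp: prod_list_zero_iff)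
  then have one: "A $$ (K + i, K + i) = 1" if "i < m" for i using zo[of "K + i"] that n by force
  show "A $$ (c, c) = 1" if "K \<le> c" "c < n" for c using one[of "c - K"] that n by simp
  have "map (\<lambda>i. A $$ (K + i, K + i)) [0..<m] = replicate m 1"
    using one by (intro nth_equalityI) auto
  then show "Determinant.det A = Determinant.det ?L" using d by (simp add: prod_list_replicate)
qed

text \<open>Some term of the Leibniz expansion is nonzero. For the coefficient matrix of the
  barycentric polynomials this matches every power of \<open>e\<close> with a vertex of its own
  whose polynomial contains that power.\<close>

lemma det_nonzero_permutation:
  assumes A: "(A :: real mat) \<in> carrier_mat n n" and "Determinant.det A \<noteq> 0"
  obtains p where "p permutes {0..<n}" "\<And>i. i < n \<Longrightarrow> A $$ (i, p i) \<noteq> 0"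
proof -
  have "(\<Sum>p\<in>{p. p permutes {0..<n}}. signof p * (\<Prod>i = 0..<n. A $$ (i, p i))) \<noteq> 0"
    using assms by (simp add: Determinant.det_def)
  then obtain p where "p permutes {0..<n}" "signof p * (\<Prod>i = 0..<n. A $$ (i, p i)) \<noteq> 0"
    by (metis (mono_tags, lifting) mem_Collect_eq sum.neutral)
  then show ?thesis using that by auto
qed

text \<open>The rows of \<open>A\<close> are the vertices of a simplex, its columns (the first one constantly 1) a
  coordinate system such that the face \<open>G\<close> is cut out by the vanishing of the columns from \<open>K\<close> on. The
  simplex contains the points with coordinates \<open>P c + e ^ c\<close> for arbitrarily small \<open>e > 0\<close>, hence meets the
  flag of faces above \<open>G\<close> in faces of the maximal dimension. Since the barycentric coordinates
  are polynomials in \<open>e\<close>, a vertex with \<open>A $$ (r, c) = 1\<close> has one of order at least \<open>c\<close>; as these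
  polynomials are linearly independent, a permutation of the vertices makes \<open>A\<close> block triangular.\<close>

lemma flag_triangularization:
  fixes A :: "real mat"
  assumes A: "A \<in> carrier_mat n n" and nz: "Determinant.det A \<noteq> 0"
    and K: "0 < K" "K \<le> n"
    and zo: "\<And>r c. r < n \<Longrightarrow> K \<le> c \<Longrightarrow> c < n \<Longrightarrow> A $$ (r, c) \<in> {0, 1}"
    and P0: "P 0 = 1" and P: "\<And>c. K \<le> c \<Longrightarrow> c < n \<Longrightarrow> P c = 0"
    and freq: "\<exists>\<^sub>F e in at_right 0. \<exists>u. (\<forall>r<n. 0 \<le> u r) \<and>
       (\<forall>c<n. (\<Sum>r = 0..<n. u r * A $$ (r, c)) = P c + (if c = 0 then 0 else e ^ c))"
  obtains p \<mu> where "p permutes {0..<n}"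
    and "\<And>b c. K \<le> c \<Longrightarrow> c < n \<Longrightarrow> b < c \<Longrightarrow> A $$ (p b, c) = 0"
    and "\<And>b. b < K \<Longrightarrow> 0 \<le> \<mu> b"
    and "\<And>c. c < n \<Longrightarrow> (\<Sum>b = 0..<K. \<mu> b * A $$ (p b, c)) = P c"
    and "\<bar>Determinant.det A\<bar> = \<bar>Determinant.det (mat K K (\<lambda>(b, c). A $$ (p b, c)))\<bar>"
proof -
  have "A \<in> Units (ring_mat TYPE(real) n ())" using det_non_zero_imp_unit[OF A nz] .
  then obtain Ai where Ai: "Ai \<in> carrier_mat n n" "A * Ai = 1\<^sub>m n" "Ai * A = 1\<^sub>m n"
    by (auto simp: Units_def ring_mat_def)
  \<comment> \<open>The row vector (1, e, ..., e^(n - 1)) times \<open>V\<close> is the curve: row 0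
    carries the point \<open>P\<close>, row \<open>a\<close> adds \<open>e ^ a\<close> to column
    \<open>a\<close>. Hence \<open>B = V * Ai\<close> holds the coefficients of the barycentric
    coordinates, with power \<open>a\<close> in row \<open>a\<close> and vertex \<open>r\<close> in
    column \<open>r\<close>.\<close>
  define V where "V = mat n n (\<lambda>(a, c). if a = 0 then P c else if a = c then 1 else 0)"
  define B where "B = V * Ai"
  have V: "V \<in> carrier_mat n n" by (simp add: V_def)
  have B: "B \<in> carrier_mat n n" using V Ai by (simp add: B_def)
  have BA: "B * A = V" using V Ai A unfolding B_def by (simp add: assoc_mult_mat[of _ n n _ n _ n])
  have "diag_mat V = replicate n 1"
    using P0 by (intro nth_equalityI) (auto simp: V_def diag_mat_def)
  moreover have "Determinant.det V = prod_list (diag_mat V)"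
    by (rule det_upper_triangular[OF _ V]) (auto simp: V_def upper_triangular_def)
  ultimately have "Determinant.det V = 1" by (simp add: prod_list_replicate)
  then have "Determinant.det B \<noteq> 0" using det_mult[OF B A] BA by auto
  then obtain p where p: "p permutes {0..<n}" and Bp: "\<And>i. i < n \<Longrightarrow> B $$ (i, p i) \<noteq> 0"
    using det_nonzero_permutation[OF B] by blast
  have pn: "p b < n" if "b < n" for b using permutes_in_image[OF p, of b] that by simp
  have weights: "u r = (\<Sum>a = 0..<n. B $$ (a, r) * e ^ a)"
    if u: "\<forall>c<n. (\<Sum>r = 0..<n. u r * A $$ (r, c)) = P c + (if c = 0 then 0 else e ^ c)"
      and r: "r < n" for u e r
  proof -
    define um where "um = mat 1 n (\<lambda>(_, r). u r)"
    define em where "em = mat 1 n (\<lambda>(_, a). e ^ a)"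
    have um: "um \<in> carrier_mat 1 n" and em: "em \<in> carrier_mat 1 n" by (auto simp: um_def em_def)
    have "um * A = em * V"
    proof (rule eq_matI)
      fix i c assume "i < dim_row (em * V)" "c < dim_col (em * V)"
      then have ic: "i = 0" "c < n" using em V by auto
      have "(um * A) $$ (i, c) = (\<Sum>r = 0..<n. u r * A $$ (r, c))"
        using A ic by (auto simp: um_def scalar_prod_def intro!: sum.cong)
      moreover have "(em * V) $$ (i, c) = (\<Sum>a = 0..<n. e ^ a * (if a = 0 then P c else if a = c then 1 else 0))"
        using ic by (auto simp: em_def V_def scalar_prod_def intro!: sum.cong)
      moreover have "\<dots> = (\<Sum>a = 0..<n. (if a = 0 then P c else 0) + (if a = c then (if c = 0 then 0 else e ^ c) else 0))"
        by (intro sum.cong) auto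
      moreover have "\<dots> = P c + (if c = 0 then 0 else e ^ c)" using ic by (simp add: sum.distrib sum.delta)
      ultimately show "(um * A) $$ (i, c) = (em * V) $$ (i, c)" using u ic by simp
    qed (use A V um em in auto)
    then have "(um * A) * Ai = (em * V) * Ai" by simp
    then have "um = em * B" using um em A V Ai unfolding B_def
      by (simp add: assoc_mult_mat[of _ 1 n _ n _ n])
    moreover have "u r = um $$ (0, r)" using r by (simp add: um_def)
    moreover have "(em * B) $$ (0, r) = (\<Sum>a = 0..<n. e ^ a * B $$ (a, r))"
      using B r em by (auto simp: em_def scalar_prod_def intro!: sum.cong)
    ultimately show ?thesis by (simp add: mult.commute)
  qed
  \<comment> \<open>In column \<open>c\<close> the curve has the value \<open>e ^ c\<close>, a sum
    of nonnegative terms one of which is \<open>u r\<close>. So \<open>u r\<close> is at most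
    \<open>e ^ c\<close>.\<close>
  have order: "B $$ (a, r) = 0" if "r < n" "K \<le> c" "c < n" "A $$ (r, c) = 1" "a < c" for a r c
  proof (rule coeffs_zero_if_frequently_small[where n = n and h = c and b = "\<lambda>a. B $$ (a, r)"])
    show "\<exists>\<^sub>F e in at_right 0. \<bar>\<Sum>a = 0..<n. B $$ (a, r) * e ^ a\<bar> \<le> e ^ c"
      using freq
    proof (rule frequently_elim1, elim exE conjE)
      fix e :: real and u :: "nat \<Rightarrow> real"
      assume u0: "\<forall>r<n. 0 \<le> u r"
        and u: "\<forall>c<n. (\<Sum>r = 0..<n. u r * A $$ (r, c)) = P c + (if c = 0 then 0 else e ^ c)"
      have "u r * A $$ (r, c) \<le> (\<Sum>r = 0..<n. u r * A $$ (r, c))"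
        using that u0 zo[OF _ that(2,3)] by (intro member_le_sum) force+
      then have "u r \<le> e ^ c" using u that P K by simp
      then show "\<bar>\<Sum>a = 0..<n. B $$ (a, r) * e ^ a\<bar> \<le> e ^ c"
        using weights[OF u] that u0 by simp
    qed
  qed (use that in auto)
  \<comment> \<open>If this entry were 1, the polynomial of vertex \<open>p b\<close> would have
    order at least \<open>c\<close> and could not contain the power \<open>b < c\<close>, contrary
    to the choice of \<open>p\<close>.\<close>
  have z: "A $$ (p b, c) = 0" if "K \<le> c" "c < n" "b < c" for b c
    using order[of "p b" c b] zo[of "p b" c] Bp[of b] pn[of b] that by force
  define A' where "A' = mat n n (\<lambda>(b, c). A $$ (p b, c))"
  have A': "A' \<in> carrier_mat n n" by (simp add: A'_def)
  have detA': "\<bar>Determinant.det A'\<bar> = \<bar>Determinant.det A\<bar>"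
    unfolding A'_def using det_permute_rows[OF A p] by (simp add: abs_mult sign_def)
  then have "Determinant.det A' \<noteq> 0" using nz by auto
  note block = det_block_lower_unitriangular[OF A' K(2) _ _ this]
  have one: "A $$ (p c, c) = 1" if "K \<le> c" "c < n" for c
    using block(1)[of c] that z zo pn by (auto simp: A'_def)
  have "Determinant.det A' = Determinant.det (mat K K (\<lambda>(b, c). A' $$ (b, c)))"
    using z zo pn by (intro block(2)) (auto simp: A'_def)
  also have "mat K K (\<lambda>(b, c). A' $$ (b, c)) = mat K K (\<lambda>(b, c). A $$ (p b, c))"
    using K by (intro eq_matI) (auto simp: A'_def)
  finally have det: "\<bar>Determinant.det A\<bar> = \<bar>Determinant.det (mat K K (\<lambda>(b, c). A $$ (p b, c)))\<bar>"
    using detA' by simp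
  have nonneg: "0 \<le> B $$ (0, r)" if r: "r < n" for r
  proof (rule ccontr)
    assume neg: "\<not> 0 \<le> B $$ (0, r)"
    have "((\<lambda>e. \<Sum>a = 0..<n. B $$ (a, r) * e ^ a) \<longlongrightarrow> (\<Sum>a = 0..<n. B $$ (a, r) * 0 ^ a)) (at_right 0)"
      by (intro tendsto_intros)
    moreover have "(\<Sum>a = 0..<n. B $$ (a, r) * 0 ^ a) = (\<Sum>a = 0..<n. if a = 0 then B $$ (a, r) else 0)"
      by (intro sum.cong) auto
    ultimately have "((\<lambda>e. \<Sum>a = 0..<n. B $$ (a, r) * e ^ a) \<longlongrightarrow> B $$ (0, r)) (at_right 0)"
      using K by (simp add: sum.delta)
    then have "\<forall>\<^sub>F e in at_right 0. (\<Sum>a = 0..<n. B $$ (a, r) * e ^ a) < 0"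
      using neg by (intro order_tendstoD(2)) auto
    moreover have "\<exists>\<^sub>F e in at_right 0. 0 \<le> (\<Sum>a = 0..<n. B $$ (a, r) * e ^ a)"
      using freq weights r by (auto elim!: frequently_elim1)
    ultimately show False
      by (auto simp: frequently_def not_le elim: eventually_mono)
  qed
  have wsum: "(\<Sum>b = 0..<K. B $$ (0, p b) * A $$ (p b, c)) = P c" if c: "c < n" for c
  proof -
    have "(\<Sum>b = 0..<K. B $$ (0, p b) * A $$ (p b, c)) = (\<Sum>b = 0..<n. B $$ (0, p b) * A $$ (p b, c))"
    proof (rule sum.mono_neutral_left)
      show "\<forall>b\<in>{0..<n} - {0..<K}. B $$ (0, p b) * A $$ (p b, c) = 0"
      proof
        fix b assume "b \<in> {0..<n} - {0..<K}"
        then have b: "K \<le> b" "b < n" by auto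
        \<comment> \<open>The diagonal entry 1 gives the polynomial of vertex \<open>p b\<close>
          order at least \<open>b\<close>, and \<open>b\<close> is positive. So it vanishes at
          \<open>e = 0\<close>, and the first \<open>K\<close> vertices alone represent
          \<open>P\<close>.\<close>
        have "B $$ (0, p b) = 0" using order[OF pn[OF b(2)] b one[OF b], of 0] b K by simp
        then show "B $$ (0, p b) * A $$ (p b, c) = 0" by simp
      qed
    qed (use K in auto)
    also have "\<dots> = (\<Sum>r = 0..<n. B $$ (0, r) * A $$ (r, c))"
      using sum.permute[OF p, of "\<lambda>r. B $$ (0, r) * A $$ (r, c)"] by (simp add: o_def)
    also have "\<dots> = (B * A) $$ (0, c)"
      using A B c K by (auto simp: scalar_prod_def intro!: sum.cong)
    also have "\<dots> = P c" using c K unfolding BA by (simp add: V_def)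
    finally show ?thesis .
  qed
  show ?thesis by (rule that[of p "\<lambda>b. B $$ (0, p b)"]) (use p z nonneg pn K wsum det in auto)
qed

subsection \<open>Products of simplices\<close>

lemma lookup_scaleR_poly_mapping [simp]:
  fixes x :: "'a \<Rightarrow>\<^sub>0 'b::real_vector"
  shows "Poly_Mapping.lookup (r *\<^sub>R x) i = r *\<^sub>R Poly_Mapping.lookup x i"
proof -
  have "finite {i. r *\<^sub>R Poly_Mapping.lookup x i \<noteq> 0}"
    by (rule finite_subset[OF _ finite_lookup[of x]]) auto
  then show ?thesis by (simp add: scaleR_poly_mapping_def)
qed

lemmas coord_simps = lookup_add lookup_minus lookup_sum

lemma point_eqI:
  assumes "\<And>p. coord x p = coord y p" shows "x = y"
  using assms by (intro poly_mapping_eqI) (metis fst_conv snd_conv)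

definition mk_point :: "(nat \<times> nat) set \<Rightarrow> (nat \<times> nat \<Rightarrow> real) \<Rightarrow> point" where
  "mk_point S h = (\<Sum>p\<in>S. Poly_Mapping.single (fst p) (Poly_Mapping.single (snd p) (h p)))"

lemma coord_mk_point [simp]:
  assumes "finite S"
  shows "Poly_Mapping.lookup (Poly_Mapping.lookup (mk_point S h) i) j = (if (i, j) \<in> S then h (i, j) else 0)"
proof -
  let ?q = "(i, j)"
  have "coord (mk_point S h) ?q = (\<Sum>p\<in>S. if p = ?q then h p else 0)"
    unfolding mk_point_def lookup_sum
    by (intro sum.cong) (auto simp: lookup_single when_def prod_eq_iff)
  then show ?thesis using assms by (simp add: sum.delta)
qed

lemma mem_coord_simplex:
  assumes "finite J"
  shows "f \<in> coord_simplex J \<longleftrightarrow> (\<forall>j. 0 \<le> Poly_Mapping.lookup f j) \<and>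
    (\<forall>j. j \<notin> J \<longrightarrow> Poly_Mapping.lookup f j = 0) \<and> (\<Sum>j\<in>J. Poly_Mapping.lookup f j) = 1"
    (is "?L \<longleftrightarrow> ?R")
proof -
  let ?e = "\<lambda>j. Poly_Mapping.single j (1::real)"
  have inj: "inj_on ?e J" by (rule inj_onI) (metis lookup_single_eq lookup_single_not_eq zero_neq_one)
  have look: "Poly_Mapping.lookup (\<Sum>j\<in>J. u j *\<^sub>R ?e j) i = (if i \<in> J then u i else 0)" for u i
  proof -
    have "Poly_Mapping.lookup (\<Sum>j\<in>J. u j *\<^sub>R ?e j) i = (\<Sum>j\<in>J. if j = i then u j else 0)"
      unfolding lookup_sum by (intro sum.cong) (auto simp: lookup_single when_def)
    then show ?thesis using assms by (simp add: sum.delta)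
  qed
  have "?L \<longleftrightarrow> (\<exists>u. (\<forall>x\<in>?e ` J. 0 \<le> u x) \<and> sum u (?e ` J) = 1 \<and> (\<Sum>x\<in>?e ` J. u x *\<^sub>R x) = f)"
    unfolding coord_simplex_def using assms by (subst convex_hull_finite) auto
  also have "\<dots> \<longleftrightarrow> (\<exists>u. (\<forall>j\<in>J. 0 \<le> u j) \<and> sum u J = 1 \<and> (\<Sum>j\<in>J. u j *\<^sub>R ?e j) = f)" (is "?A = ?B")
  proof
    assume ?A
    then obtain u where "(\<forall>x\<in>?e ` J. 0 \<le> u x) \<and> sum u (?e ` J) = 1 \<and> (\<Sum>x\<in>?e ` J. u x *\<^sub>R x) = f"
      by blast
    then show ?B using inj by (intro exI[of _ "\<lambda>j. u (?e j)"]) (simp add: sum.reindex)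
  next
    assume ?B
    then obtain u where u: "(\<forall>j\<in>J. 0 \<le> u j) \<and> sum u J = 1 \<and> (\<Sum>j\<in>J. u j *\<^sub>R ?e j) = f" by blast
    then show ?A using inj
      by (intro exI[of _ "\<lambda>x. u (inv_into J ?e x)"]) (simp add: sum.reindex inv_into_f_f[OF inj])
  qed
  also have "\<dots> \<longleftrightarrow> ?R"
  proof
    assume ?B
    then obtain u where u: "\<forall>j\<in>J. 0 \<le> u j" "sum u J = 1" "f = (\<Sum>j\<in>J. u j *\<^sub>R ?e j)" by blast
    have "Poly_Mapping.lookup f i = (if i \<in> J then u i else 0)" for i
      unfolding u(3) by (rule look)
    then show ?R using u(1,2) by simp
  next
    assume R: ?R
    have "(\<Sum>j\<in>J. Poly_Mapping.lookup f j *\<^sub>R ?e j) = f"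
      by (rule poly_mapping_eqI) (use R in \<open>auto simp: look\<close>)
    then show ?B using R by blast
  qed
  finally show ?thesis .
qed

text \<open>Arbitrary finite nonempty coordinate sets \<open>J i\<close> are allowed so that the
  simplotope and each of its product faces are instances of one locale.\<close>

locale simplex_product =
  fixes n :: nat and J :: "nat \<Rightarrow> nat set"
  assumes finite_J: "i < n \<Longrightarrow> finite (J i)" and nonempty_J: "i < n \<Longrightarrow> J i \<noteq> {}"
begin

abbreviation G :: "point set" where "G \<equiv> block_product n (\<lambda>i. coord_simplex (J i))"

lemma mem_G:
  "x \<in> G \<longleftrightarrow> (\<forall>p. 0 \<le> coord x p) \<and> (\<forall>i j. n \<le> i \<or> j \<notin> J i \<longrightarrow> coord x (i, j) = 0) \<and>
     (\<forall>i<n. (\<Sum>j\<in>J i. coord x (i, j)) = 1)" (is "_ \<longleftrightarrow> ?A \<and> ?B \<and> ?C")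
proof -
  have "Poly_Mapping.keys x \<subseteq> {..<n} \<longleftrightarrow> (\<forall>i j. n \<le> i \<longrightarrow> coord x (i, j) = 0)"
    unfolding subset_iff in_keys_iff
    by (auto simp: poly_mapping_eq_iff fun_eq_iff not_less) (metis not_less)
  moreover have "(\<forall>i<n. Poly_Mapping.lookup x i \<in> coord_simplex (J i)) \<longleftrightarrow>
     (\<forall>i<n. (\<forall>j. 0 \<le> coord x (i, j)) \<and> (\<forall>j. j \<notin> J i \<longrightarrow> coord x (i, j) = 0) \<and>
            (\<Sum>j\<in>J i. coord x (i, j)) = 1)"
    using finite_J by (simp add: mem_coord_simplex)
  ultimately have "x \<in> G \<longleftrightarrow> (\<forall>i j. n \<le> i \<longrightarrow> coord x (i, j) = 0) \<and>
     (\<forall>i<n. (\<forall>j. 0 \<le> coord x (i, j)) \<and> (\<forall>j. j \<notin> J i \<longrightarrow> coord x (i, j) = 0) \<and>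
            (\<Sum>j\<in>J i. coord x (i, j)) = 1)"
    unfolding block_product_def by simp
  also have "\<dots> \<longleftrightarrow> ?A \<and> ?B \<and> ?C"
    by (auto simp: split_paired_all) (metis leI order_refl)+
  finally show ?thesis .
qed

lemma coord_nonneg: "x \<in> G \<Longrightarrow> 0 \<le> coord x p"
  and coord_zero: "x \<in> G \<Longrightarrow> n \<le> i \<or> j \<notin> J i \<Longrightarrow> coord x (i, j) = 0"
  and coord_sum: "x \<in> G \<Longrightarrow> i < n \<Longrightarrow> (\<Sum>j\<in>J i. coord x (i, j)) = 1"
  by (auto simp: mem_G)

lemma coord_le_1:
  assumes "x \<in> G" shows "coord x p \<le> 1"
proof (cases p)
  case (Pair i j)
  show ?thesis
  proof (cases "i < n \<and> j \<in> J i")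
    case True
    then have "coord x (i, j) \<le> (\<Sum>j\<in>J i. coord x (i, j))"
      using assms finite_J coord_nonneg by (intro member_le_sum[of j "J i" "\<lambda>j. coord x (i, j)"]) auto
    then show ?thesis using coord_sum[OF assms] True Pair by simp
  next
    case False
    then show ?thesis using coord_zero[OF assms, of i j] Pair by auto
  qed
qed

text \<open>A coordinate strictly between 0 and 1 is accompanied by another positive one in its
  block, since the block sums to 1. Moving mass between the two in both directions exhibits the
  point as the midpoint of a segment in the product.\<close>

lemma vertex_01:
  assumes v: "v \<in> vertices G" shows "v \<in> G" "coord v p \<in> {0, 1}"
proof -
  have ext: "v extreme_point_of G" using v by (simp add: vertices_def)
  then show vG: "v \<in> G" by (simp add: extreme_point_of_def)
  show "coord v p \<in> {0, 1}"
  proof (rule ccontr)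
    assume not01: "coord v p \<notin> {0, 1}"
    obtain i j where p: "p = (i, j)" by (cases p)
    have ij: "i < n" "j \<in> J i" using not01 coord_zero[OF vG, of i j] p by force+
    have lt: "0 < coord v p" "coord v p < 1"
      using coord_nonneg[OF vG, of p] coord_le_1[OF vG, of p] not01 by auto
    obtain j' where j': "j' \<in> J i" "j' \<noteq> j" "coord v (i, j') \<noteq> 0"
    proof (rule ccontr)
      assume *: "\<not> thesis"
      then have "(\<Sum>j'\<in>J i. coord v (i, j')) = (\<Sum>j'\<in>J i. if j' = j then coord v (i, j') else 0)"
        using that by (intro sum.cong) auto
      then show False using coord_sum[OF vG ij(1)] finite_J ij lt p by (simp add: sum.delta)
    qed
    have j'pos: "0 < coord v (i, j')" using coord_nonneg[OF vG, of "(i, j')"] j'(3) by linarith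
    define d where "d = min (coord v (i, j)) (coord v (i, j'))"
    define m where "m s = v + mk_point {(i, j), (i, j')} (\<lambda>q. if q = (i, j) then s else - s)" for s
    have cm: "coord (m s) q = coord v q + (if q = (i, j) then s else if q = (i, j') then - s else 0)" for s q
      by (simp add: m_def coord_simps)
    have mG: "m s \<in> G" if "\<bar>s\<bar> \<le> d" for s
      unfolding mem_G
    proof (intro conjI allI impI)
      fix q show "0 \<le> coord (m s) q"
        using coord_nonneg[OF vG, of q] that unfolding cm d_def by auto
    next
      fix a b assume "n \<le> a \<or> b \<notin> J a"
      then show "coord (m s) (a, b) = 0"
        using coord_zero[OF vG, of a b] ij j' unfolding cm by auto
    next
      fix a assume a: "a < n"
      have "(\<Sum>b\<in>J a. coord (m s) (a, b)) = (\<Sum>b\<in>J a. coord v (a, b))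
        + (\<Sum>b\<in>J a. (if b = j then if a = i then s else 0 else 0) + (if b = j' then if a = i then - s else 0 else 0))"
        unfolding cm sum.distrib[symmetric] using j' by (intro sum.cong) auto
      also have "\<dots> = 1" using coord_sum[OF vG a] finite_J[OF a] ij j'
        by (auto simp: sum.distrib sum.delta)
      finally show "(\<Sum>b\<in>J a. coord (m s) (a, b)) = 1" .
    qed
    have d: "d > 0" using lt p j'pos by (simp add: d_def)
    have "m d \<noteq> m (- d)"
    proof
      assume "m d = m (- d)"
      then have "coord (m d) (i, j) = coord (m (- d)) (i, j)" by simp
      then show False using d unfolding cm by simp
    qed
    moreover have "v = (1 - 1 / 2) *\<^sub>R m d + (1 / 2) *\<^sub>R m (- d)"
      by (rule point_eqI) (auto simp: coord_simps cm field_simps)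
    ultimately have "v \<in> open_segment (m d) (m (- d))"
      unfolding in_segment by (intro conjI exI[of _ "1/2"]) auto
    then show False using ext mG[of d] mG[of "- d"] d by (auto simp: extreme_point_of_def)
  qed
qed

text \<open>0 and 1 are the ends of the range of a coordinate, so a proper convex combination
  attains one of them only if both end points do.\<close>

lemma vertexI:
  assumes v: "v \<in> G" and zo: "\<And>p. coord v p \<in> {0, 1}" shows "v \<in> vertices G"
  unfolding vertices_def extreme_point_of_def mem_Collect_eq
proof (intro conjI ballI notI)
  fix a b assume ab: "a \<in> G" "b \<in> G" "v \<in> open_segment a b"
  then obtain u where u: "0 < u" "u < 1" "v = (1 - u) *\<^sub>R a + u *\<^sub>R b" and ne: "a \<noteq> b"
    by (auto simp: in_segment)
  have "a = b"
  proof (rule point_eqI)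
    fix p
    have c: "coord v p = (1 - u) * coord a p + u * coord b p" by (simp add: u(3) coord_simps)
    have r: "0 \<le> coord a p" "coord a p \<le> 1" "0 \<le> coord b p" "coord b p \<le> 1"
      using ab coord_nonneg coord_le_1 by auto
    show "coord a p = coord b p"
    proof (cases "coord v p = 0")
      case True
      have "0 \<le> (1 - u) * coord a p" "0 \<le> u * coord b p" using u r by auto
      then have "(1 - u) * coord a p = 0" "u * coord b p = 0" using c True by linarith+
      then show ?thesis using u by simp
    next
      case False
      then have "(1 - u) * (1 - coord a p) + u * (1 - coord b p) = 0"
        using c zo[of p] by (auto simp: algebra_simps)
      moreover have "0 \<le> (1 - u) * (1 - coord a p)" "0 \<le> u * (1 - coord b p)" using u r by auto
      ultimately have "(1 - u) * (1 - coord a p) = 0" "u * (1 - coord b p) = 0" by linarith+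
      then show ?thesis using u by simp
    qed
  qed
  then show False using ne by simp
qed (rule v)

lemma vertex_of_choice:
  assumes w: "\<And>i. i < n \<Longrightarrow> w i \<in> J i"
  obtains v where "v \<in> vertices G" "\<And>p. coord v p = (if fst p < n \<and> snd p = w (fst p) then 1 else 0)"
proof -
  define v where "v = mk_point ((\<lambda>i. (i, w i)) ` {..<n}) (\<lambda>_. 1)"
  have c: "coord v p = (if fst p < n \<and> snd p = w (fst p) then 1 else 0)" for p
    by (cases p) (auto simp: v_def)
  have "(\<Sum>j\<in>J i. if j = w i then 1 else 0) = (1::real)" if "i < n" for i
    using w[OF that] finite_J[OF that] by (simp add: sum.delta)
  then have "v \<in> G" unfolding mem_G c using w by auto
  then have "v \<in> vertices G" by (rule vertexI) (auto simp: c)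
  then show ?thesis using c by (rule that)
qed

lemma choice_of_vertex:
  assumes v: "v \<in> vertices G"
  obtains w where "\<And>i. i < n \<Longrightarrow> w i \<in> J i" "\<And>i j. i < n \<Longrightarrow> coord v (i, j) = (if j = w i then 1 else 0)"
proof -
  have "\<exists>k. k \<in> J i \<and> (\<forall>j. coord v (i, j) = (if j = k then 1 else 0))" if i: "i < n" for i
  proof -
    have sum: "(\<Sum>j\<in>J i. coord v (i, j)) = 1" using coord_sum[OF vertex_01(1)[OF v] i] .
    have "\<exists>k\<in>J i. coord v (i, k) \<noteq> 0"
    proof (rule ccontr)
      assume "\<not> (\<exists>k\<in>J i. coord v (i, k) \<noteq> 0)"
      then have "(\<Sum>j\<in>J i. coord v (i, j)) = 0" by simp
      then show False using sum by simp
    qed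
    then obtain k where k: "k \<in> J i" "coord v (i, k) \<noteq> 0" by blast
    then have k1: "coord v (i, k) = 1" using vertex_01(2)[OF v, of "(i, k)"] by auto
    have "(\<Sum>j\<in>J i - {k}. coord v (i, j)) = 0"
      using sum k1 k(1) finite_J[OF i] by (simp add: sum.remove[of "J i" k])
    then have "\<forall>j\<in>J i - {k}. coord v (i, j) = 0"
      using finite_J[OF i] coord_nonneg[OF vertex_01(1)[OF v]] by (subst (asm) sum_nonneg_eq_0_iff) auto
    then have "\<forall>j. coord v (i, j) = (if j = k then 1 else 0)"
      using k1 coord_zero[OF vertex_01(1)[OF v], of i] by auto
    then show ?thesis using k by blast
  qed
  then have "\<forall>i. \<exists>k. i < n \<longrightarrow> k \<in> J i \<and> (\<forall>j. coord v (i, j) = (if j = k then 1 else 0))" by simp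
  then obtain w where "\<forall>i. i < n \<longrightarrow> w i \<in> J i \<and> (\<forall>j. coord v (i, j) = (if j = w i then 1 else 0))"
    unfolding choice_iff by blast
  then show ?thesis by (intro that[of w]) auto
qed

lemma vertices_nonempty: "vertices G \<noteq> {}"
proof -
  have "\<And>i. i < n \<Longrightarrow> (SOME j. j \<in> J i) \<in> J i" using nonempty_J some_in_eq by auto
  then show ?thesis by (rule vertex_of_choice[of "\<lambda>i. SOME j. j \<in> J i"]) auto
qed

lemma vertex_with_coord:
  assumes "i < n" "j \<in> J i"
  obtains v where "v \<in> vertices G" "coord v (i, j) = 1"
proof -
  have "\<And>a. a < n \<Longrightarrow> (if a = i then j else SOME j. j \<in> J a) \<in> J a"
    using nonempty_J some_in_eq assms by auto
  then show ?thesis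
    by (rule vertex_of_choice[of "\<lambda>a. if a = i then j else SOME j. j \<in> J a"]) (use that assms in auto)
qed

lemma nonvanishing_coord_iff: "(\<exists>x\<in>G. coord x (i, j) \<noteq> 0) \<longleftrightarrow> i < n \<and> j \<in> J i"
proof
  assume "i < n \<and> j \<in> J i"
  then obtain v where "v \<in> vertices G" "coord v (i, j) = 1" using vertex_with_coord by blast
  then show "\<exists>x\<in>G. coord x (i, j) \<noteq> 0" using vertex_01(1) by (intro bexI[of _ v]) auto
next
  assume "\<exists>x\<in>G. coord x (i, j) \<noteq> 0"
  then show "i < n \<and> j \<in> J i" using coord_zero[of _ i j] by (meson not_le)
qed

section \<open>Reduced coordinates, class and dimension\<close>

definition red :: "point \<Rightarrow> (nat \<times> nat) set" where
  "red v = {(i, j). i < n \<and> j \<in> J i \<and> coord v (i, j) \<noteq> 1}"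

lemma red_subset: "red v \<subseteq> Sigma {..<n} J" by (auto simp: red_def)

lemma finite_red [simp]: "finite (red v)"
  by (rule finite_subset[OF red_subset]) (use finite_J in auto)

lemma card_red:
  assumes "v \<in> vertices G" shows "card (red v) = (\<Sum>i<n. card (J i) - 1)"
proof -
  obtain w where w: "\<And>i. i < n \<Longrightarrow> w i \<in> J i" "\<And>i j. i < n \<Longrightarrow> coord v (i, j) = (if j = w i then 1 else 0)"
    using choice_of_vertex[OF assms] by blast
  have "red v = (SIGMA i:{..<n}. J i - {w i})" using w by (auto simp: red_def)
  then have "card (red v) = (\<Sum>i<n. card (J i - {w i}))" using finite_J by simp
  then show ?thesis using w finite_J by simp
qed

text \<open>The leading constant function is the column of ones of \<open>class_matrix\<close>.
  Hence column \<open>c > 0\<close> belongs to the coordinate \<open>ps ! (c - 1)\<close>.\<close>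

abbreviation cols :: "(nat \<times> nat) list \<Rightarrow> (point \<Rightarrow> real) list" where
  "cols ps \<equiv> (\<lambda>_. 1) # map (\<lambda>p x. coord x p) ps"

text \<open>The one coordinate of a block missing from \<open>red v\<close> is 1 minus the others,
  an integer combination thanks to the constant column.\<close>

lemma int_comb_cols:
  assumes v: "v \<in> vertices G" and ps: "set ps = red v" and ij: "i < n" "j \<in> J i"
  shows "int_comb G (cols ps) (\<lambda>x. coord x (i, j))"
proof (cases "(i, j) \<in> red v")
  case True
  then have "(\<lambda>x. coord x (i, j)) \<in> (\<lambda>p x. coord x p) ` set ps" using ps by (intro image_eqI) auto
  then show ?thesis by (intro int_comb_member) auto
next
  case False
  obtain w where w: "\<And>i. i < n \<Longrightarrow> w i \<in> J i" "\<And>i j. i < n \<Longrightarrow> coord v (i, j) = (if j = w i then 1 else 0)"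
    using choice_of_vertex[OF v] by blast
  have j: "j = w i" using False ij w(2) by (auto simp: red_def split: if_splits)
  have "int_comb G (cols ps) (\<lambda>x. 1 - (\<Sum>b\<in>J i - {j}. coord x (i, b)))"
  proof (intro int_comb_diff int_comb_sum)
    fix b assume "b \<in> J i - {j}"
    then have "(i, b) \<in> set ps" using ps ij w(2) j by (auto simp: red_def)
    then have "(\<lambda>x. coord x (i, b)) \<in> (\<lambda>p x. coord x p) ` set ps" by (intro image_eqI) auto
    then show "int_comb G (cols ps) (\<lambda>x. coord x (i, b))" by (intro int_comb_member) auto
  qed (use finite_J ij in \<open>auto intro!: int_comb_member\<close>)
  then show ?thesis
  proof (rule int_comb_cong)
    fix x assume "x \<in> G"
    then have "coord x (i, j) + (\<Sum>b\<in>J i - {j}. coord x (i, b)) = 1"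
      using coord_sum[OF _ ij(1)] sum.remove[of "J i" j "\<lambda>b. coord x (i, b)"] ij finite_J by simp
    then show "1 - (\<Sum>b\<in>J i - {j}. coord x (i, b)) = coord x (i, j)" by simp
  qed
qed

text \<open>This makes the arbitrary choices in \<open>simplex_class\<close> harmless: on
  \<open>G\<close> the reduced coordinates at two vertices are integer combinations of each other
  and of 1, and reordering the points changes only the sign.\<close>

lemma abs_det_cols_eq:
  assumes v: "v \<in> vertices G" "set ps = red v" "distinct ps"
    and v': "v' \<in> vertices G" "set ps' = red v'" "distinct ps'"
    and vs: "distinct vs" "set vs \<subseteq> G" "length vs = Suc (card (red v))"
    and vs': "distinct vs'" "set vs' = set vs"
  shows "\<bar>Determinant.det (eval_mat vs (cols ps))\<bar> = \<bar>Determinant.det (eval_mat vs' (cols ps'))\<bar>"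
proof -
  have len: "length (cols ps) = length vs" "length (cols ps') = length vs"
    using v v' vs card_red[OF v(1)] card_red[OF v'(1)] distinct_card[of ps] distinct_card[of ps'] by auto
  have *: "int_comb G (cols qs) f" if "f \<in> set (cols qs')" "set qs' \<subseteq> Sigma {..<n} J"
    "w \<in> vertices G" "set qs = red w" for f qs qs' w
  proof -
    have "f = (\<lambda>_. 1) \<or> f \<in> (\<lambda>p x. coord x p) ` set qs'" using that(1) by simp
    then consider "f = (\<lambda>_. 1)" | p where "p \<in> set qs'" "f = (\<lambda>x. coord x p)" by blast
    then show ?thesis
    proof cases
      case 2
      then show ?thesis using int_comb_cols[OF that(3,4), of "fst p" "snd p"] that(2) by force
    qed (auto intro: int_comb_member)
  qed
  have "\<bar>Determinant.det (eval_mat vs (cols ps))\<bar> = \<bar>Determinant.det (eval_mat vs (cols ps'))\<bar>"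
  proof (rule abs_det_eval_mat_eq[OF len(2,1) vs(2)])
    have sub: "set ps \<subseteq> Sigma {..<n} J" "set ps' \<subseteq> Sigma {..<n} J"
      using v(2) v'(2) red_subset by simp_all
    show "int_comb G (cols ps') f" if "f \<in> set (cols ps)" for f
      using *[OF that sub(1) v'(1,2)] .
    show "int_comb G (cols ps) f" if "f \<in> set (cols ps')" for f
      using *[OF that sub(2) v(1,2)] .
  qed
  also have "\<dots> = \<bar>Determinant.det (eval_mat vs' (cols ps'))\<bar>"
    using vs vs' len by (intro abs_det_eval_mat_reorder) auto
  finally show ?thesis .
qed

text \<open>Replaces both \<open>SOME\<close> choices by whatever vertex and enumerations are at
  hand. The bound 3 is the range in which \<open>reduced_coords\<close> looks for
  coordinates.\<close>

lemma simplex_class_eq: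
  assumes st: "n = s + t" and J3: "\<And>i. i < n \<Longrightarrow> J i \<subseteq> {..<3}"
    and v: "v \<in> vertices G" "set ps = red v" "distinct ps"
    and vs: "distinct vs" "set vs \<subseteq> G" "length vs = Suc (card (red v))"
  shows "simplex_class s t G (set vs) = \<bar>Determinant.det (eval_mat vs (cols ps))\<bar>"
proof -
  define v0 where "v0 = (SOME v. v \<in> vertices G)"
  define vs0 where "vs0 = (SOME ws. set ws = set vs \<and> distinct ws)"
  have v0: "v0 \<in> vertices G" unfolding v0_def using vertices_nonempty some_in_eq by blast
  have vs0: "set vs0 = set vs" "distinct vs0"
    using someI[of "\<lambda>ws. set ws = set vs \<and> distinct ws" vs] vs(1) unfolding vs0_def by auto
  let ?ps = "reduced_coords s t G v0"
  have "set ?ps = red v0"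
  proof (rule Set.set_eqI)
    fix p :: "nat \<times> nat"
    obtain i j where p: "p = (i, j)" by (cases p)
    show "p \<in> set ?ps \<longleftrightarrow> p \<in> red v0"
      unfolding p reduced_coords_def red_def using nonvanishing_coord_iff[of i j] J3[of i] st by auto
  qed
  moreover have "distinct ?ps"
    unfolding reduced_coords_def by (intro distinct_filter distinct_product) auto
  ultimately have "\<bar>Determinant.det (eval_mat vs (cols ps))\<bar> = \<bar>Determinant.det (eval_mat vs0 (cols ?ps))\<bar>"
    using vs vs0 by (intro abs_det_cols_eq[OF v v0]) auto
  moreover have "class_matrix s t G v0 vs0 = eval_mat vs0 (cols ?ps)"
    unfolding class_matrix_def eval_mat_def Let_def
    by (rule cong_mat) (auto simp: nth_Cons' )
  ultimately show ?thesis unfolding simplex_class_def Let_def v0_def[symmetric] vs0_def[symmetric] by simp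
qed

text \<open>The directions from \<open>v\<close> to its neighbours, one for each reduced coordinate,
  form a basis. They are independent because their reduced coordinates are unit vectors. They span
  because a difference of two points of \<open>G\<close> has block sums 0, so that its deleted
  coordinates follow from the reduced ones.\<close>

lemma affine_dimension_G:
  assumes v: "v \<in> vertices G" shows "affine_dimension G = card (red v)"
proof -
  obtain w where w: "\<And>i. i < n \<Longrightarrow> w i \<in> J i" "\<And>i j. i < n \<Longrightarrow> coord v (i, j) = (if j = w i then 1 else 0)"
    using choice_of_vertex[OF v] by blast
  have vG: "v \<in> G" using vertex_01(1)[OF v] .
  define b where "b p = mk_point {p, (fst p, w (fst p))} (\<lambda>q. if q = p then 1 else - 1)" for p
  have cb: "coord (b p) q = (if q = p then 1 else 0)" if "p \<in> red v" "q \<in> red v" for p q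
    using that w(2) by (auto simp: b_def red_def)
  have inj: "inj_on b (red v)" by (rule inj_onI) (metis cb zero_neq_one)
  have indep: "independent (b ` red v)"
  proof
    assume "dependent (b ` red v)"
    then obtain u where u: "(\<Sum>x\<in>b ` red v. u x *\<^sub>R x) = 0" "\<exists>x\<in>b ` red v. u x \<noteq> 0"
      by (subst (asm) dependent_finite) auto
    have "u (b q) = 0" if q: "q \<in> red v" for q
    proof -
      have "0 = coord (\<Sum>p\<in>red v. u (b p) *\<^sub>R b p) q" using u(1) inj by (simp add: sum.reindex)
      also have "\<dots> = (\<Sum>p\<in>red v. if p = q then u (b p) else 0)"
        unfolding lookup_sum using cb[OF _ q] by (intro sum.cong) auto
      finally show ?thesis using q by (simp add: sum.delta)
    qed
    then show False using u(2) by auto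
  qed
  have sub: "b ` red v \<subseteq> {x - y | x y. x \<in> G \<and> y \<in> G}"
  proof (rule image_subsetI)
    fix p assume p: "p \<in> red v"
    obtain i j where "p = (i, j)" by (cases p)
    then have ij: "p = (i, j)" "i < n" "j \<in> J i" "j \<noteq> w i" using p w(2)[of i j] by (auto simp: red_def)
    have wj: "(w(i := j)) a \<in> J a" if "a < n" for a using w ij that by auto
    obtain x where x: "x \<in> vertices G"
      "\<And>p. coord x p = (if fst p < n \<and> snd p = (w(i := j)) (fst p) then 1 else 0)"
      using vertex_of_choice[OF wj] by blast
    have "b p = x - v"
    proof (rule point_eqI)
      fix q :: "nat \<times> nat" obtain a c where q: "q = (a, c)" by (cases q)
      have "coord v (a, c) = 0" if "n \<le> a" using coord_zero[OF vG] that by simp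
      then show "coord (b p) q = coord (x - v) q"
        using ij w(2)[of a c] q by (cases "a < n") (auto simp: b_def coord_simps x(2)[of "(a, c)", simplified])
    qed
    then show "b p \<in> {x - y | x y. x \<in> G \<and> y \<in> G}" using vertex_01(1)[OF x(1)] vG by blast
  qed
  have "{x - y | x y. x \<in> G \<and> y \<in> G} \<subseteq> span (b ` red v)"
  proof clarify
    fix x y assume xy: "x \<in> G" "y \<in> G"
    have "x - y = (\<Sum>p\<in>red v. coord (x - y) p *\<^sub>R b p)"
    proof (rule point_eqI)
      fix q :: "nat \<times> nat" obtain a c where q: "q = (a, c)" by (cases q)
      consider "n \<le> a \<or> c \<notin> J a" | "q \<in> red v" | "a < n" "c = w a"
        using q w(2) by (force simp: red_def)
      then show "coord (x - y) q = coord (\<Sum>p\<in>red v. coord (x - y) p *\<^sub>R b p) q"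
      proof cases
        case 1
        then have "coord (b p) q = 0" if "p \<in> red v" for p using that w(1) q by (auto simp: b_def red_def)
        then show ?thesis using 1 coord_zero[OF xy(1)] coord_zero[OF xy(2)] q
          by (simp add: lookup_sum lookup_minus)
      next
        case 2
        have "(\<Sum>p\<in>red v. coord (x - y) p * coord (b p) q) = (\<Sum>p\<in>red v. if p = q then coord (x - y) p else 0)"
          using cb[OF _ 2] by (intro sum.cong) auto
        then show ?thesis using 2 by (simp add: lookup_sum sum.delta)
      next
        case 3
        have rd: "red v = (SIGMA i:{..<n}. J i - {w i})" using w by (auto simp: red_def)
        have "(\<Sum>p\<in>red v. coord (x - y) p * coord (b p) q) =
          (\<Sum>i<n. \<Sum>j\<in>J i - {w i}. coord (x - y) (i, j) * coord (b (i, j)) q)"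
          unfolding rd using finite_J by (subst sum.Sigma) (auto intro!: sum.cong)
        also have "\<dots> = (\<Sum>i<n. if i = a then \<Sum>j\<in>J a - {w a}. - coord (x - y) (a, j) else 0)"
        proof (rule sum.cong[OF refl])
          fix i assume "i \<in> {..<n}"
          show "(\<Sum>j\<in>J i - {w i}. coord (x - y) (i, j) * coord (b (i, j)) q) =
            (if i = a then \<Sum>j\<in>J a - {w a}. - coord (x - y) (a, j) else 0)"
            using q 3 by (auto simp: b_def intro!: sum.cong sum.neutral)
        qed
        also have "\<dots> = - (\<Sum>j\<in>J a - {w a}. coord (x - y) (a, j))" using 3 by (simp add: sum.delta sum_negf)
        also have "\<dots> = coord (x - y) (a, w a)"
        proof -
          have "(\<Sum>j\<in>J a. coord (x - y) (a, j)) = 0"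
            using coord_sum[OF xy(1) 3(1)] coord_sum[OF xy(2) 3(1)] by (simp add: lookup_minus sum_subtractf)
          then show ?thesis using finite_J[OF 3(1)] w(1)[OF 3(1)] by (simp add: sum.remove[of "J a" "w a"])
        qed
        finally show ?thesis using q 3 by (simp add: lookup_sum)
      qed
    qed
    also have "\<dots> \<in> span (b ` red v)" by (intro span_sum span_scale span_base) auto
    finally show "x - y \<in> span (b ` red v)" .
  qed
  then show ?thesis unfolding affine_dimension_def
    using dim_unique[OF sub _ indep] card_image[OF inj] by simp
qed

end

section \<open>Affine dependence and lattice points in a product of simplices\<close>

context simplex_product
begin

lemma coord_via_cols:
  assumes "v \<in> vertices G" "set ps = red v"
  obtains T :: "nat \<Rightarrow> real" where
    "\<And>x. x \<in> G \<Longrightarrow> coord x p = (\<Sum>c = 0..<length (cols ps). (cols ps ! c) x * T c)"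
proof -
  obtain i j where p: "p = (i, j)" by (cases p)
  show ?thesis
  proof (cases "i < n \<and> j \<in> J i")
    case True
    then obtain T :: "nat \<Rightarrow> int"
      where "\<forall>x\<in>G. coord x p = (\<Sum>c = 0..<length (cols ps). (cols ps ! c) x * of_int (T c))"
      using int_comb_cols[OF assms, of i j] p unfolding int_comb_def by blast
    then show ?thesis by (intro that[of "\<lambda>c. of_int (T c)"]) blast
  next
    case False
    then show ?thesis using coord_zero[of _ i j] p by (intro that[of "\<lambda>_. 0"]) auto
  qed
qed

text \<open>On \<open>G\<close> every coordinate is a fixed linear combination of the columns, so a
  relation checked on the columns holds for the points themselves.\<close>

lemma combination_zero_if_cols_zero:
  assumes "v \<in> vertices G" "set ps = red v"
    and x: "\<And>b. b \<in> B \<Longrightarrow> x b \<in> G"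
    and z: "\<And>c. c < length (cols ps) \<Longrightarrow> (\<Sum>b\<in>B. u b * (cols ps ! c) (x b)) = 0"
  shows "(\<Sum>b\<in>B. u b *\<^sub>R x b) = 0"
proof (rule point_eqI)
  fix p
  obtain T :: "nat \<Rightarrow> real" where
    T: "\<And>x. x \<in> G \<Longrightarrow> coord x p = (\<Sum>c = 0..<length (cols ps). (cols ps ! c) x * T c)"
    using coord_via_cols[OF assms(1,2)] by blast
  have "coord (\<Sum>b\<in>B. u b *\<^sub>R x b) p = (\<Sum>b\<in>B. u b * coord (x b) p)" by (simp add: lookup_sum)
  also have "\<dots> = (\<Sum>b\<in>B. \<Sum>c = 0..<length (cols ps). u b * (cols ps ! c) (x b) * T c)"
    by (intro sum.cong refl) (simp only: T[OF x] sum_distrib_left mult.assoc)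
  also have "\<dots> = (\<Sum>c = 0..<length (cols ps). (\<Sum>b\<in>B. u b * (cols ps ! c) (x b)) * T c)"
    by (subst sum.swap) (simp only: sum_distrib_right)
  also have "\<dots> = 0" using z by (intro sum.neutral) simp
  finally show "coord (\<Sum>b\<in>B. u b *\<^sub>R x b) p = coord 0 p" by simp
qed

lemma combination_eq_if_cols_eq:
  fixes x :: "nat \<Rightarrow> point" and u :: "nat \<Rightarrow> real"
  assumes "v \<in> vertices G" "set ps = red v" and y: "y \<in> G"
    and x: "\<And>b. b < m \<Longrightarrow> x b \<in> G"
    and z: "\<And>c. c < length (cols ps) \<Longrightarrow> (\<Sum>b = 0..<m. u b * (cols ps ! c) (x b)) = (cols ps ! c) y"
  shows "(\<Sum>b = 0..<m. u b *\<^sub>R x b) = y"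
proof -
  \<comment> \<open>The target \<open>y\<close> joins as one more point of weight -1, which turns
    the equation into a vanishing combination.\<close>
  let ?u = "u(m := - 1)" and ?x = "x(m := y)"
  have "(\<Sum>b = 0..<Suc m. ?u b *\<^sub>R ?x b) = 0"
    by (rule combination_zero_if_cols_zero[OF assms(1,2)]) (use x y z in auto)
  then show ?thesis by simp
qed

text \<open>A vector in the kernel of the transposed matrix is an affine dependence: the constant
  column says that the weights sum to 0, the other columns that the weighted sum of the points
  vanishes.\<close>

lemma det_cols_nonzero:
  assumes v: "v \<in> vertices G" "set ps = red v" "distinct ps"
    and vs: "distinct vs" "set vs \<subseteq> G" "length vs = Suc (card (red v))"
    and ind: "\<not> affine_dependent (set vs)"
  shows "Determinant.det (eval_mat vs (cols ps)) \<noteq> 0"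
proof
  let ?m = "length vs" and ?A = "eval_mat vs (cols ps)"
  assume d: "Determinant.det ?A = 0"
  have len: "length (cols ps) = ?m" using v vs distinct_card[of ps] by simp
  have A: "?A \<in> carrier_mat ?m ?m" using eval_mat_carrier[of vs "cols ps"] unfolding len .
  have AT: "transpose_mat ?A \<in> carrier_mat ?m ?m" using A by simp
  have "Determinant.det (transpose_mat ?A) = 0" using d det_transpose[OF A] by simp
  then obtain y where y: "y \<in> carrier_vec ?m" "y \<noteq> 0\<^sub>v ?m" "transpose_mat ?A *\<^sub>v y = 0\<^sub>v ?m"
    using det_0_iff_vec_prod_zero_field[OF AT] by blast
  have z: "(\<Sum>r = 0..<?m. vec_index y r * (cols ps ! c) (vs ! r)) = 0" if c: "c < ?m" for c
  proof -
    have "0 = vec_index (transpose_mat ?A *\<^sub>v y) c" using y(3) c by simp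
    also have "\<dots> = (\<Sum>r = 0..<?m. ?A $$ (r, c) * vec_index y r)"
      using A y(1) c by (auto simp: scalar_prod_def intro!: sum.cong)
    finally show ?thesis using c len by (simp add: mult.commute)
  qed
  have "(\<Sum>r = 0..<?m. vec_index y r *\<^sub>R vs ! r) = 0"
    by (rule combination_zero_if_cols_zero[OF v(1,2)]) (use z vs len in auto)
  moreover have "(\<Sum>r = 0..<?m. vec_index y r) = 0" using z[of 0] vs(3) by simp
  moreover obtain r where r: "r < ?m" "vec_index y r \<noteq> 0"
    using y(1,2) by (metis carrier_vecD eq_vecI index_zero_vec(1) index_zero_vec(2))
  moreover define U where "U x = vec_index y (inv_into {0..<?m} ((!) vs) x)" for x
  have bij: "bij_betw ((!) vs) {0..<?m} (set vs)" using bij_betw_nth[OF vs(1)] by (simp add: atLeast0LessThan)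
  then have U: "U (vs ! r) = vec_index y r" if "r < ?m" for r
    unfolding U_def using that by (simp add: bij_betw_inv_into_left)
  ultimately have "sum U (set vs) = 0" "(\<Sum>x\<in>set vs. U x *\<^sub>R x) = 0" "U (vs ! r) \<noteq> 0"
    by (simp_all flip: sum.reindex_bij_betw[OF bij] add: U)
  then show False using ind r by (subst (asm) affine_dependent_explicit_finite) (auto intro: nth_mem)
qed

lemma det_cols_int:
  assumes "set vs \<subseteq> vertices G" "length vs = length (cols ps)"
  obtains M where "M \<in> carrier_mat (length vs) (length vs)" "eval_mat vs (cols ps) = map_mat of_int M"
    "Determinant.det (eval_mat vs (cols ps)) = of_int (Determinant.det M)"
proof (rule det_eval_mat_int)
  fix f x assume f: "f \<in> set (cols ps)" and "x \<in> set vs"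
  then have "coord x p \<in> {0, 1}" for p using assms vertex_01(2) by blast
  then have "coord x p \<in> \<int>" for p by (metis Ints_0 Ints_1 insert_iff singletonD)
  then show "f x \<in> \<int>" using f by auto
qed (use assms that in auto)

lemma card_lattice_points_hull_le:
  assumes vs: "distinct vs" "set vs \<subseteq> vertices G" "length vs = Suc k" and ps: "length ps = k"
    and d: "Determinant.det (eval_mat vs (cols ps)) \<noteq> 0" and N: "N > 0"
  defines "S \<equiv> {p \<in> convex hull set vs. \<forall>q. real N * coord p q \<in> \<int>}"
  shows "finite S" "real (card S) \<le> \<bar>Determinant.det (eval_mat vs (cols ps))\<bar> * real ((N + k) choose k)"
proof -
  obtain M where M: "M \<in> carrier_mat (length vs) (length vs)" "eval_mat vs (cols ps) = map_mat of_int M"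
    "Determinant.det (eval_mat vs (cols ps)) = of_int (Determinant.det M)"
    using det_cols_int[OF vs(2), of ps] vs ps by auto
  have Mrc: "of_int (M $$ (r, c)) = (cols ps ! c) (vs ! r)" if "r \<le> k" "c \<le> k" for r c
    using arg_cong[OF M(2), of "\<lambda>A. A $$ (r, c)"] M(1) that vs(3) ps by simp
  define W where "W = {\<mu>. (\<forall>r\<le>k. 0 \<le> \<mu> r) \<and> (\<forall>r>k. \<mu> r = 0) \<and> (\<Sum>r\<le>k. \<mu> r) = real N \<and>
      (\<forall>c\<le>k. (\<Sum>r\<le>k. \<mu> r * of_int (M $$ (r, c))) \<in> \<int>)}"
  have W: "finite W" "int (card W) \<le> \<bar>Determinant.det M\<bar> * int ((N + k) choose k)"
    unfolding W_def using card_lattice_points_simplex_le[of M k N] M(1,3) vs(3) d by auto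
  have sub: "S \<subseteq> (\<lambda>\<mu>. \<Sum>r\<le>k. (\<mu> r / real N) *\<^sub>R vs ! r) ` W"
  proof
    fix p assume p: "p \<in> S"
    then obtain u where u: "\<forall>x\<in>set vs. 0 \<le> u x" "sum u (set vs) = 1" "(\<Sum>x\<in>set vs. u x *\<^sub>R x) = p"
      unfolding S_def by (subst (asm) convex_hull_finite) auto
    have bij: "bij_betw ((!) vs) {..k} (set vs)"
      using bij_betw_nth[OF vs(1)] vs(3) by (simp add: lessThan_Suc_atMost)
    have u': "(\<Sum>r\<le>k. u (vs ! r)) = 1" "(\<Sum>r\<le>k. u (vs ! r) *\<^sub>R vs ! r) = p"
      using u(2,3) sum.reindex_bij_betw[OF bij, of u] sum.reindex_bij_betw[OF bij, of "\<lambda>x. u x *\<^sub>R x"] by auto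
    \<comment> \<open>Scaling the barycentric coordinates by \<open>N\<close> turns column 0 into
      the total \<open>N\<close> and every other column into \<open>N\<close> times a coordinate of
      \<open>p\<close>, an integer by the choice of \<open>p\<close>.\<close>
    define \<mu> where "\<mu> r = (if r \<le> k then real N * u (vs ! r) else 0)" for r
    have "(\<Sum>r\<le>k. \<mu> r * of_int (M $$ (r, c))) \<in> \<int>" if c: "c \<le> k" for c
    proof -
      have "(\<Sum>r\<le>k. \<mu> r * of_int (M $$ (r, c))) = real N * (\<Sum>r\<le>k. u (vs ! r) * (cols ps ! c) (vs ! r))"
        using c by (simp add: \<mu>_def Mrc sum_distrib_left mult.assoc)
      also have "\<dots> \<in> \<int>"
      proof (cases c)
        case 0
        then show ?thesis using u'(1) by simp
      next
        case (Suc a)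
        then have "(\<Sum>r\<le>k. u (vs ! r) * (cols ps ! c) (vs ! r)) = coord p (ps ! a)"
          using c ps by (simp add: lookup_sum flip: u'(2))
        then show ?thesis using p by (simp add: S_def)
      qed
      finally show ?thesis .
    qed
    moreover have "0 \<le> \<mu> r" if "r \<le> k" for r using u(1) vs(3) that by (simp add: \<mu>_def)
    moreover have "(\<Sum>r\<le>k. \<mu> r) = real N" using u'(1) by (simp add: \<mu>_def flip: sum_distrib_left)
    ultimately have "\<mu> \<in> W" unfolding W_def by (simp add: \<mu>_def)
    moreover have "p = (\<Sum>r\<le>k. (\<mu> r / real N) *\<^sub>R vs ! r)" using N u'(2) by (simp add: \<mu>_def)
    ultimately show "p \<in> (\<lambda>\<mu>. \<Sum>r\<le>k. (\<mu> r / real N) *\<^sub>R vs ! r) ` W" by blast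
  qed
  show "finite S" using finite_subset[OF sub] W(1) by simp
  have "card S \<le> card W" using surj_card_le[OF W(1) sub] .
  then have "int (card S) \<le> \<bar>Determinant.det M\<bar> * int ((N + k) choose k)" using W(2) by linarith
  then have "real_of_int (int (card S)) \<le> real_of_int (\<bar>Determinant.det M\<bar> * int ((N + k) choose k))"
    by (simp only: of_int_le_iff)
  then show "real (card S) \<le> \<bar>Determinant.det (eval_mat vs (cols ps))\<bar> * real ((N + k) choose k)"
    using M(3) by simp
qed

definition interior_lattice :: "nat \<Rightarrow> point set" where
  "interior_lattice N = {p \<in> G. (\<forall>i<n. \<forall>j\<in>J i. 0 < coord p (i, j)) \<and> (\<forall>q. real N * coord p q \<in> \<int>)}"

text \<open>In a block, \<open>N\<close> times the coordinates are positive integers with sum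
  \<open>N\<close>. Subtracting 1 from each leaves arbitrary naturals with sum
  \<open>N - card (J i)\<close>, which stars and bars counts. The finiteness assumption is
  discharged by the upper bound through simplices.\<close>

lemma card_interior_lattice_ge:
  assumes N: "\<And>i. i < n \<Longrightarrow> card (J i) \<le> N" "N > 0" and fin: "finite (interior_lattice N)"
  shows "(\<Prod>i<n. (N - 1) choose (N - card (J i))) \<le> card (interior_lattice N)"
proof -
  define L where "L i = {l::nat list. size l = card (J i) \<and> sum_list l = N - card (J i)}" for i
  have card_J: "card (J i) > 0" if "i < n" for i using finite_J nonempty_J that by (simp add: card_gt_0_iff)
  have card_L: "card (L i) = (N - 1) choose (N - card (J i))" if "i < n" for i
    unfolding L_def using N(1)[OF that] by (subst card_length_sum_list) simp
  have "\<forall>i. \<exists>e. i < n \<longrightarrow> bij_betw e (J i) {0..<card (J i)}"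
    using finite_J ex_bij_betw_finite_nat by blast
  then obtain e where e: "\<And>i. i < n \<Longrightarrow> bij_betw (e i) (J i) {0..<card (J i)}" by metis
  define h where "h g = mk_point (Sigma {..<n} J) (\<lambda>(i, j). (real (g i ! e i j) + 1) / real N)"
    for g :: "nat \<Rightarrow> nat list"
  have fS: "finite (Sigma {..<n} J)" using finite_J by auto
  have ch: "Poly_Mapping.lookup (Poly_Mapping.lookup (h g) i) j = (if i < n \<and> j \<in> J i then (real (g i ! e i j) + 1) / real N else 0)" for g i j
    using coord_mk_point[OF fS] by (auto simp: h_def)
  have "h g \<in> interior_lattice N" if g: "g \<in> PiE {..<n} L" for g
  proof -
    have "(\<Sum>j\<in>J i. (real (g i ! e i j) + 1) / real N) = 1" if i: "i < n" for i
    proof -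
      have l: "size (g i) = card (J i)" "sum_list (g i) = N - card (J i)"
        using PiE_mem[OF g, of i] i unfolding L_def by auto
      have "(\<Sum>j\<in>J i. (real (g i ! e i j) + 1) / real N) = (\<Sum>b = 0..<card (J i). (real (g i ! b) + 1) / real N)"
        using sum.reindex_bij_betw[OF e[OF i], of "\<lambda>b. (real (g i ! b) + 1) / real N"] .
      also have "\<dots> = (real (\<Sum>b = 0..<card (J i). g i ! b) + real (card (J i))) / real N"
        by (simp add: sum_divide_distrib[symmetric] sum.distrib)
      also have "(\<Sum>b = 0..<card (J i). g i ! b) = N - card (J i)"
        using l sum_list_sum_nth[of "g i"] by simp
      finally show ?thesis using N i by (simp add: of_nat_diff)
    qed
    then have "h g \<in> G" unfolding mem_G by (auto simp: ch split_paired_all)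
    moreover have "real N * coord (h g) q \<in> \<int>" for q
      using N(2) by (cases q) (auto simp: ch)
    ultimately show ?thesis unfolding interior_lattice_def using N(2) by (auto simp: ch intro!: divide_pos_pos)
  qed
  moreover have "inj_on h (PiE {..<n} L)"
  proof (rule inj_onI)
    fix g g' assume g: "g \<in> PiE {..<n} L" "g' \<in> PiE {..<n} L" and eq: "h g = h g'"
    show "g = g'"
    proof (rule PiE_ext[OF g])
      fix i assume "i \<in> {..<n}"
      then have i: "i < n" by simp
      have l: "size (g i) = card (J i)" "size (g' i) = card (J i)"
        using PiE_mem[OF g(1), of i] PiE_mem[OF g(2), of i] i unfolding L_def by auto
      show "g i = g' i"
      proof (rule nth_equalityI)
        fix b assume "b < length (g i)"
        then obtain j where j: "j \<in> J i" "e i j = b"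
          using e[OF i] l unfolding bij_betw_def by (metis atLeastLessThan_iff image_iff zero_le)
        have "coord (h g) (i, j) = coord (h g') (i, j)" using eq by simp
        then show "g i ! b = g' i ! b" using i j N(2) by (simp add: ch)
      qed (use l in simp)
    qed
  qed
  ultimately have "card (PiE {..<n} L) \<le> card (interior_lattice N)"
    using fin by (intro card_inj_on_le[of h]) auto
  moreover have "card (PiE {..<n} L) = (\<Prod>i<n. (N - 1) choose (N - card (J i)))"
    using card_L by (subst card_PiE) auto
  ultimately show ?thesis by simp
qed

end

subsection \<open>Faces and covers\<close>

context simplex_product
begin

text \<open>The direction from the vertex chosen by \<open>w\<close> to a neighbour: it adds 1 to
  the coordinate \<open>p\<close> at the expense of the deleted coordinate of the same block, so
  that no other reduced coordinate changes.\<close>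

definition edge :: "(nat \<Rightarrow> nat) \<Rightarrow> nat \<times> nat \<Rightarrow> point" where
  "edge w p = mk_point {p, (fst p, w (fst p))} (\<lambda>q. if q = p then 1 else - 1)"

lemma coord_edge:
  "coord (edge w p) q = (if q = p then 1 else if q = (fst p, w (fst p)) then - 1 else 0)"
  by (simp add: edge_def)

lemma sum_coord_edge:
  assumes "p \<in> Sigma {..<n} J" "w (fst p) \<in> J (fst p)" "snd p \<noteq> w (fst p)" "i < n"
  shows "(\<Sum>j\<in>J i. coord (edge w p) (i, j)) = 0"
proof -
  obtain a c where p: "p = (a, c)" by (cases p)
  have "(\<Sum>j\<in>J i. coord (edge w p) (i, j)) =
     (\<Sum>j\<in>J i. (if j = c then if i = a then 1 else 0 else 0) + (if j = w a then if i = a then - 1 else 0 else 0))"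
    using assms unfolding coord_edge p by (intro sum.cong) auto
  also have "\<dots> = 0" using assms finite_J[OF assms(4)] p by (simp add: sum.distrib sum.delta)
  finally show ?thesis .
qed

end

locale simplex_product_face = F: simplex_product n J + P: simplex_product n D
  for n :: nat and J D :: "nat \<Rightarrow> nat set" +
  assumes J_sub: "i < n \<Longrightarrow> J i \<subseteq> D i"
begin

lemma face_sub: "F.G \<subseteq> P.G"
proof
  fix x assume x: "x \<in> F.G"
  have "(\<Sum>j\<in>D i. coord x (i, j)) = (\<Sum>j\<in>J i. coord x (i, j))" if "i < n" for i
    using J_sub[OF that] P.finite_J[OF that] F.coord_zero[OF x] by (intro sum.mono_neutral_right) auto
  then show "x \<in> P.G"
    unfolding P.mem_G
  proof (intro conjI allI impI)
    fix i j assume "n \<le> i \<or> j \<notin> D i"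
    then have "n \<le> i \<or> j \<notin> J i" using J_sub[of i] by (cases "i < n") auto
    then show "coord x (i, j) = 0" using F.coord_zero[OF x] by blast
  qed (use F.coord_sum[OF x] F.coord_nonneg[OF x] in auto)
qed

lemma mem_face_iff:
  assumes "x \<in> P.G"
  shows "x \<in> F.G \<longleftrightarrow> (\<forall>i<n. \<forall>j\<in>D i - J i. coord x (i, j) = 0)"
proof
  assume z: "\<forall>i<n. \<forall>j\<in>D i - J i. coord x (i, j) = 0"
  have zero: "coord x (i, j) = 0" if "n \<le> i \<or> j \<notin> J i" for i j
    using z P.coord_zero[OF assms, of i j] that by (metis DiffI leI)
  have "(\<Sum>j\<in>D i. coord x (i, j)) = (\<Sum>j\<in>J i. coord x (i, j))" if "i < n" for i
    using J_sub[OF that] P.finite_J[OF that] zero by (intro sum.mono_neutral_right) auto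
  then show "x \<in> F.G"
    using P.coord_sum[OF assms] zero P.coord_nonneg[OF assms] unfolding F.mem_G by simp
qed (use F.coord_zero in blast)

lemma vertices_face_sub: "vertices F.G \<subseteq> vertices P.G"
  using F.vertex_01 face_sub P.vertexI by blast

lemma vertices_face_iff: "v \<in> vertices P.G \<Longrightarrow> v \<in> vertices F.G \<longleftrightarrow> v \<in> F.G"
  using F.vertex_01 P.vertex_01 F.vertexI by blast

text \<open>The deleted coordinate of each block lies in \<open>J i\<close> because \<open>v\<close>
  belongs to the face. So a list of the reduced coordinates of the product may start with those of
  the face, and the rest are the coordinates whose vanishing cuts out the face.\<close>

lemma red_diff:
  assumes "v \<in> vertices F.G"
  shows "F.red v \<subseteq> P.red v" and "P.red v - F.red v = {(i, j). i < n \<and> j \<in> D i - J i}"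
proof -
  have "coord v (i, j) = 0" if "j \<notin> J i" for i j
    using F.coord_zero[OF F.vertex_01(1)[OF assms]] that by blast
  then show "F.red v \<subseteq> P.red v" "P.red v - F.red v = {(i, j). i < n \<and> j \<in> D i - J i}"
    using J_sub by (auto simp: F.red_def P.red_def)
qed

text \<open>For \<open>e > 0\<close> only the deleted coordinates \<open>w i\<close> can decrease.
  They are positive at the relative interior point \<open>p\<close>, so they stay nonnegative for
  small \<open>e\<close>.\<close>

lemma curve_in_polytope:
  assumes v: "v \<in> vertices F.G" and w: "\<And>i. i < n \<Longrightarrow> w i \<in> J i"
      "\<And>i j. i < n \<Longrightarrow> coord v (i, j) = (if j = w i then 1 else 0)"
    and p: "p \<in> F.G" "\<And>i j. i < n \<Longrightarrow> j \<in> J i \<Longrightarrow> 0 < coord p (i, j)"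
    and cs: "set cs = P.red v"
  shows "\<forall>\<^sub>F e in at_right 0. p + (\<Sum>c<length cs. e ^ Suc c *\<^sub>R P.edge w (cs ! c)) \<in> P.G"
proof -
  let ?x = "\<lambda>e. p + (\<Sum>c<length cs. e ^ Suc c *\<^sub>R P.edge w (cs ! c))"
  have pP: "p \<in> P.G" using p(1) face_sub by blast
  have wD: "w i \<in> D i" if "i < n" for i using w(1) J_sub that by blast
  have red: "cs ! c \<in> Sigma {..<n} D" "snd (cs ! c) \<noteq> w (fst (cs ! c))" if "c < length cs" for c
  proof -
    have "cs ! c \<in> P.red v" using cs nth_mem[OF that] by simp
    then show "cs ! c \<in> Sigma {..<n} D" "snd (cs ! c) \<noteq> w (fst (cs ! c))"
      using w(2) by (auto simp: P.red_def)
  qed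
  have cx: "coord (?x e) q = coord p q + (\<Sum>c<length cs. e ^ Suc c * coord (P.edge w (cs ! c)) q)" for e q
    by (simp add: lookup_add lookup_sum)
  have "\<forall>\<^sub>F e in at_right 0. \<forall>i\<in>{..<n}. 0 \<le> coord p (i, w i) - (\<Sum>c<length cs. e ^ Suc c)"
  proof (rule eventually_ball_finite, simp, rule ballI)
    fix i assume "i \<in> {..<n}"
    have "((\<lambda>e::real. coord p (i, w i) - (\<Sum>c<length cs. e ^ Suc c)) \<longlongrightarrow>
        coord p (i, w i) - (\<Sum>c<length cs. 0 ^ Suc c)) (at_right 0)"
      by (intro tendsto_intros)
    then have "((\<lambda>e::real. coord p (i, w i) - (\<Sum>c<length cs. e ^ Suc c)) \<longlongrightarrow> coord p (i, w i)) (at_right 0)"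
      by simp
    then have "\<forall>\<^sub>F e in at_right 0. 0 < coord p (i, w i) - (\<Sum>c<length cs. e ^ Suc c)"
      by (rule order_tendstoD(1)) (use p(2) w(1) \<open>i \<in> {..<n}\<close> in simp)
    then show "\<forall>\<^sub>F e in at_right 0. 0 \<le> coord p (i, w i) - (\<Sum>c<length cs. e ^ Suc c)"
      by (rule eventually_mono) simp
  qed
  moreover have "\<forall>\<^sub>F e::real in at_right 0. 0 < e" by (rule eventually_at_right_less)
  ultimately show ?thesis
  proof eventually_elim
    case (elim e)
    show "?x e \<in> P.G"
      unfolding P.mem_G
    proof (intro conjI allI impI)
      fix q :: "nat \<times> nat"
      obtain i j where q: "q = (i, j)" by (cases q)
      show "0 \<le> coord (?x e) q"
      proof (cases "i < n \<and> j = w i")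
        case True
        \<comment> \<open>A crude bound: every power of \<open>e\<close> is charged to this
          coordinate, although only the edges of its own block lower it.\<close>
        have "(\<Sum>c<length cs. - (e ^ Suc c)) \<le> (\<Sum>c<length cs. e ^ Suc c * coord (P.edge w (cs ! c)) q)"
        proof (rule sum_mono)
          fix c
          have "- 1 \<le> coord (P.edge w (cs ! c)) q" unfolding P.coord_edge by simp
          then have "e ^ Suc c * - 1 \<le> e ^ Suc c * coord (P.edge w (cs ! c)) q"
            using elim(2) by (intro mult_left_mono) auto
          then show "- (e ^ Suc c) \<le> e ^ Suc c * coord (P.edge w (cs ! c)) q" by simp
        qed
        moreover have "0 \<le> coord p q - (\<Sum>c<length cs. e ^ Suc c)" using elim(1) True q by auto
        ultimately show ?thesis unfolding cx sum_negf by linarith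
      next
        case False
        have "0 \<le> e ^ Suc c * coord (P.edge w (cs ! c)) q" if "c < length cs" for c
          using False q red(1)[OF that] elim(2) unfolding P.coord_edge by auto
        then have "0 \<le> (\<Sum>c<length cs. e ^ Suc c * coord (P.edge w (cs ! c)) q)" by (intro sum_nonneg) auto
        then show ?thesis unfolding cx using P.coord_nonneg[OF pP, of q] by linarith
      qed
    next
      fix i j assume ij: "n \<le> i \<or> j \<notin> D i"
      have "coord (P.edge w (cs ! c)) (i, j) = 0" if "c < length cs" for c
        using red(1)[OF that] wD ij unfolding P.coord_edge by auto
      then show "coord (?x e) (i, j) = 0" unfolding cx using P.coord_zero[OF pP ij] by simp
    next
      fix i assume i: "i < n"
      have "(\<Sum>j\<in>D i. coord (?x e) (i, j)) = (\<Sum>j\<in>D i. coord p (i, j))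
          + (\<Sum>c<length cs. e ^ Suc c * (\<Sum>j\<in>D i. coord (P.edge w (cs ! c)) (i, j)))"
        unfolding cx sum.distrib sum_distrib_left by (subst sum.swap) simp
      also have "\<dots> = 1"
      proof -
        have "(\<Sum>j\<in>D i. coord (P.edge w (cs ! c)) (i, j)) = 0" if "c < length cs" for c
          using red[OF that] wD i by (intro P.sum_coord_edge) auto
        then show ?thesis using P.coord_sum[OF pP i] by simp
      qed
      finally show "(\<Sum>j\<in>D i. coord (?x e) (i, j)) = 1" .
    qed
  qed
qed

lemma cover_restricts_to_face:
  assumes st: "n = s + t" and D3: "\<And>i. i < n \<Longrightarrow> D i \<subseteq> {..<3}"
    and C: "finite C" "\<And>\<alpha>. \<alpha> \<in> C \<Longrightarrow> \<alpha> \<subseteq> vertices P.G"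
      "\<And>\<alpha>. \<alpha> \<in> C \<Longrightarrow> card \<alpha> = Suc (card (P.red v))" "\<And>\<alpha>. \<alpha> \<in> C \<Longrightarrow> \<not> affine_dependent \<alpha>"
      "P.G \<subseteq> (\<Union>\<alpha>\<in>C. convex hull \<alpha>)"
    and v: "v \<in> vertices F.G"
    and p: "p \<in> F.G" "\<And>i j. i < n \<Longrightarrow> j \<in> J i \<Longrightarrow> 0 < coord p (i, j)"
  shows "\<exists>\<alpha>\<in>C. \<exists>\<tau>\<subseteq>\<alpha>. \<tau> \<subseteq> vertices F.G \<and> card \<tau> = Suc (card (F.red v)) \<and>
    simplex_class s t F.G \<tau> = simplex_class s t P.G \<alpha> \<and> p \<in> convex hull \<tau>"
proof -
  obtain w where w: "\<And>i. i < n \<Longrightarrow> w i \<in> J i"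
    "\<And>i j. i < n \<Longrightarrow> coord v (i, j) = (if j = w i then 1 else 0)"
    using F.choice_of_vertex[OF v] by blast
  have vP: "v \<in> vertices P.G" using v vertices_face_sub by blast
  obtain ps qs where ps: "set ps = F.red v" "distinct ps" and qs: "set qs = P.red v - F.red v" "distinct qs"
    using finite_distinct_list F.finite_red P.finite_red finite_Diff by metis
  \<comment> \<open>The coordinates of the face precede those that vanish on it, so the columns from
    \<open>K\<close> on cut out the face. Any order within \<open>qs\<close> gives a flag.\<close>
  define cs where "cs = ps @ qs"
  have cs: "set cs = P.red v" "distinct cs" using ps qs red_diff(1)[OF v] by (auto simp: cs_def)
  define K where "K = Suc (length ps)"
  define m where "m = Suc (length cs)"
  let ?fs = "P.cols cs"
  have lfs: "length ?fs = m" by (simp add: m_def)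
  have mP: "m = Suc (card (P.red v))" using cs distinct_card by (fastforce simp: m_def)
  have K: "0 < K" "K \<le> m" by (auto simp: K_def m_def cs_def)
  have KF: "K = Suc (card (F.red v))" using ps distinct_card by (fastforce simp: K_def)
  have cs_hi: "cs ! (c - 1) \<in> set qs" "0 < c" if "K \<le> c" "c < m" for c
    using that by (auto simp: cs_def K_def m_def nth_append)
  have qs_hi: "\<exists>c. K \<le> c \<and> c < m \<and> cs ! (c - 1) = q" if "q \<in> set qs" for q
  proof -
    obtain a where a: "a < length qs" "qs ! a = q" using \<open>q \<in> set qs\<close> by (auto simp: in_set_conv_nth)
    then show ?thesis by (intro exI[of _ "K + a"]) (auto simp: K_def m_def cs_def nth_append)
  qed
  \<comment> \<open>Edge \<open>c\<close> has order \<open>Suc c\<close> because column 0 is the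
    constant function. So column \<open>c > 0\<close> of the curve exceeds its value at
    \<open>p\<close> by exactly \<open>e ^ c\<close>.\<close>
  define x where "x e = p + (\<Sum>c<length cs. e ^ Suc c *\<^sub>R P.edge w (cs ! c))" for e :: real
  have fx: "(?fs ! c) (x e) = (?fs ! c) p + (if c = 0 then 0 else e ^ c)" if "c < m" for c e
  proof (cases c)
    case (Suc a)
    have a: "a < length cs" using Suc that by (simp add: m_def)
    have "cs ! a \<in> P.red v" using cs(1) nth_mem[OF a] by simp
    then have "snd (cs ! a) \<noteq> w (fst (cs ! a))" using w(2) by (auto simp: P.red_def)
    moreover have "fst (cs ! a) < n" using \<open>cs ! a \<in> P.red v\<close> by (auto simp: P.red_def)
    ultimately have "coord (P.edge w (cs ! b)) (cs ! a) = (if b = a then 1 else 0)" if "b < length cs" for b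
      using nth_eq_iff_index_eq[OF cs(2) that a] by (auto simp: P.coord_edge prod_eq_iff)
    then have "(\<Sum>b<length cs. e ^ Suc b * coord (P.edge w (cs ! b)) (cs ! a))
        = (\<Sum>b<length cs. if b = a then e ^ Suc b else 0)" by (intro sum.cong) auto
    also have "\<dots> = e ^ c" using a Suc by (simp add: sum.delta)
    finally show ?thesis using Suc a by (simp add: x_def lookup_add lookup_sum)
  qed simp
  have "\<forall>\<^sub>F e in at_right 0. \<exists>\<alpha>\<in>C. x e \<in> convex hull \<alpha>"
    using curve_in_polytope[OF v w p cs(1)] C(5) unfolding x_def by (auto elim!: eventually_mono)
  then have "\<exists>\<^sub>F e in at_right 0. \<exists>\<alpha>\<in>C. x e \<in> convex hull \<alpha>"
    by (rule eventually_frequently[rotated]) simp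
  then have "\<exists>\<alpha>\<in>C. \<exists>\<^sub>F e in at_right 0. x e \<in> convex hull \<alpha>"
    by (rule frequently_bex_finite[OF C(1)])
  \<comment> \<open>For every small \<open>e\<close> the curve is in some simplex, and the cover is
    finite; so one simplex contains it for \<open>e\<close> arbitrarily close to 0.\<close>
  then obtain \<alpha> where \<alpha>: "\<alpha> \<in> C" and freq: "\<exists>\<^sub>F e in at_right 0. x e \<in> convex hull \<alpha>" by blast
  have \<alpha>V: "\<alpha> \<subseteq> vertices P.G" using C(2)[OF \<alpha>] .
  have \<alpha>G: "\<alpha> \<subseteq> P.G" using \<alpha>V P.vertex_01(1) by blast
  have c\<alpha>: "card \<alpha> = m" using C(3)[OF \<alpha>] mP by simp
  then have "finite \<alpha>" using card_ge_0_finite[of \<alpha>] by (simp add: m_def)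
  then obtain as where as: "set as = \<alpha>" "distinct as" using finite_distinct_list by blast
  have las: "length as = m" using as c\<alpha> distinct_card by fastforce
  define A where "A = eval_mat as ?fs"
  have A: "A \<in> carrier_mat m m" unfolding A_def using eval_mat_carrier[of as ?fs] unfolding las lfs .
  have Arc: "A $$ (r, c) = (?fs ! c) (as ! r)" if "r < m" "c < m" for r c
    unfolding A_def using that las lfs by (intro eval_mat_index) simp_all
  have dA: "Determinant.det A \<noteq> 0"
    unfolding A_def using C(4)[OF \<alpha>] \<alpha>G as las mP by (intro P.det_cols_nonzero[OF vP cs]) auto
  have hi: "(?fs ! c) y = coord y (cs ! (c - 1))" if "0 < c" "c < m" for c y
    using that by (cases c) (auto simp: m_def)
  have zo: "A $$ (r, c) \<in> {0, 1}" if "r < m" "K \<le> c" "c < m" for r c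
  proof -
    have "as ! r \<in> \<alpha>" using as(1) las that(1) nth_mem[of r as] by simp
    then have "as ! r \<in> vertices P.G" using \<alpha>V by blast
    moreover have "A $$ (r, c) = coord (as ! r) (cs ! (c - 1))"
      using Arc[of r c] hi[of c] cs_hi(2)[OF that(2,3)] that by simp
    ultimately show ?thesis using P.vertex_01(2)[of "as ! r" "cs ! (c - 1)"] by simp
  qed
  have P0: "(?fs ! c) p = 0" if "K \<le> c" "c < m" for c
  proof -
    have "cs ! (c - 1) \<in> P.red v - F.red v" using cs_hi[OF that] qs by simp
    then have "snd (cs ! (c - 1)) \<notin> J (fst (cs ! (c - 1)))" unfolding red_diff(2)[OF v] by auto
    then show ?thesis using F.coord_zero[OF p(1)] hi[of c] cs_hi[OF that] that by simp
  qed
  have P00: "(?fs ! 0) p = 1" by simp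
  have freq': "\<exists>\<^sub>F e in at_right 0. \<exists>u. (\<forall>r<m. 0 \<le> u r) \<and>
     (\<forall>c<m. (\<Sum>r = 0..<m. u r * A $$ (r, c)) = (?fs ! c) p + (if c = 0 then 0 else e ^ c))"
    using freq
  proof (rule frequently_elim1)
    fix e :: real assume "x e \<in> convex hull \<alpha>"
    then obtain u where u: "\<forall>y\<in>\<alpha>. 0 \<le> u y" "sum u \<alpha> = 1" "(\<Sum>y\<in>\<alpha>. u y *\<^sub>R y) = x e"
      using \<open>finite \<alpha>\<close> by (subst (asm) convex_hull_finite) auto
    have bij: "bij_betw ((!) as) {0..<m} \<alpha>"
      using bij_betw_nth[OF as(2)] as(1) las by (simp add: atLeast0LessThan)
    have "(\<Sum>r = 0..<m. u (as ! r) * A $$ (r, c)) = (?fs ! c) p + (if c = 0 then 0 else e ^ c)"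
      if c: "c < m" for c
    proof -
      have "(\<Sum>r = 0..<m. u (as ! r) * A $$ (r, c)) = (\<Sum>r = 0..<m. u (as ! r) * (?fs ! c) (as ! r))"
        using c by (intro sum.cong) (auto simp: Arc)
      also have "\<dots> = (\<Sum>y\<in>\<alpha>. u y * (?fs ! c) y)"
        using sum.reindex_bij_betw[OF bij, of "\<lambda>y. u y * (?fs ! c) y"] .
      also have "\<dots> = (?fs ! c) (x e)"
      proof (cases "c = 0")
        case False
        then have "(\<Sum>y\<in>\<alpha>. u y * (?fs ! c) y) = coord (\<Sum>y\<in>\<alpha>. u y *\<^sub>R y) (cs ! (c - 1))"
          using hi c by (simp add: lookup_sum)
        then show ?thesis using u(3) hi c False by simp
      qed (use u(2) in simp)
      finally show ?thesis using fx[OF c] by simp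
    qed
    then show "\<exists>u. (\<forall>r<m. 0 \<le> u r) \<and>
     (\<forall>c<m. (\<Sum>r = 0..<m. u r * A $$ (r, c)) = (?fs ! c) p + (if c = 0 then 0 else e ^ c))"
      using u(1) as las by (intro exI[of _ "\<lambda>r. u (as ! r)"]) auto
  qed
  obtain \<pi> \<mu> where \<pi>: "\<pi> permutes {0..<m}"
    and tri: "\<And>b c. K \<le> c \<Longrightarrow> c < m \<Longrightarrow> b < c \<Longrightarrow> A $$ (\<pi> b, c) = 0"
    and \<mu>: "\<And>b. b < K \<Longrightarrow> 0 \<le> \<mu> b"
      "\<And>c. c < m \<Longrightarrow> (\<Sum>b = 0..<K. \<mu> b * A $$ (\<pi> b, c)) = (?fs ! c) p"
    and det: "\<bar>Determinant.det A\<bar> = \<bar>Determinant.det (mat K K (\<lambda>(b, c). A $$ (\<pi> b, c)))\<bar>"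
    using flag_triangularization[where P = "\<lambda>c. (?fs ! c) p", OF A dA K zo P00 P0 freq'] by blast
  have \<pi>m: "\<pi> b < m" if "b < m" for b using permutes_in_image[OF \<pi>, of b] that by simp
  \<comment> \<open>The first \<open>K\<close> vertices in the permuted order form the desired face
    of the simplex: triangularity makes all columns from \<open>K\<close> on vanish at them.\<close>
  define bs where "bs = map (\<lambda>b. as ! \<pi> b) [0..<K]"
  have lbs: "length bs = K" by (simp add: bs_def)
  have bsn: "bs ! b = as ! \<pi> b" if "b < K" for b using that by (simp add: bs_def)
  have "inj_on (\<lambda>b. as ! \<pi> b) {0..<K}"
  proof (rule inj_onI)
    fix b b' assume "b \<in> {0..<K}" "b' \<in> {0..<K}" "as ! \<pi> b = as ! \<pi> b'"
    then have "\<pi> b = \<pi> b'" using nth_eq_iff_index_eq[OF as(2)] \<pi>m K las by simp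
    then show "b = b'" using permutes_inj[OF \<pi>] by (simp add: inj_eq)
  qed
  then have dbs: "distinct bs" by (simp add: bs_def distinct_map)
  have bsub: "set bs \<subseteq> \<alpha>" using as(1) las \<pi>m K by (auto simp: bs_def)
  have bF: "set bs \<subseteq> vertices F.G"
  proof
    fix y assume y: "y \<in> set bs"
    then obtain b where b: "b < K" "y = as ! \<pi> b" by (auto simp: bs_def)
    have yP: "y \<in> vertices P.G" using y bsub \<alpha>V by blast
    have "coord y q = 0" if "q \<in> P.red v - F.red v" for q
    proof -
      have "q \<in> set qs" using that qs(1) by simp
      from qs_hi[OF this] obtain c where c: "K \<le> c" "c < m" "cs ! (c - 1) = q"
        by (elim exE conjE)
      have "\<pi> b < m" by (rule \<pi>m) (use b(1) K(2) in linarith)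
      then have "(?fs ! c) y = A $$ (\<pi> b, c)" unfolding b(2) by (rule Arc[OF _ c(2), symmetric])
      also have "\<dots> = 0" by (rule tri[OF c(1,2)]) (use b(1) c(1) in linarith)
      finally show ?thesis unfolding hi[OF cs_hi(2)[OF c(1,2)] c(2)] c(3) .
    qed
    then have "\<forall>i<n. \<forall>j\<in>D i - J i. coord y (i, j) = 0" unfolding red_diff(2)[OF v] by blast
    then have "y \<in> F.G" unfolding mem_face_iff[OF P.vertex_01(1)[OF yP]] .
    then show "y \<in> vertices F.G" using vertices_face_iff[OF yP] by simp
  qed
  have bG: "set bs \<subseteq> F.G" using bF F.vertex_01(1) by blast
  have lo: "(F.cols ps ! c) = ?fs ! c" if "c < K" for c
    using that by (auto simp: cs_def K_def nth_Cons' nth_append)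
  have "(\<Sum>b = 0..<K. \<mu> b *\<^sub>R bs ! b) = p"
  proof (rule F.combination_eq_if_cols_eq[OF v ps(1) p(1)])
    fix b assume "b < K" then show "bs ! b \<in> F.G" using bG lbs by (metis nth_mem subsetD)
  next
    fix c assume "c < length (F.cols ps)"
    then have c: "c < K" by (simp add: K_def)
    have "(\<Sum>b = 0..<K. \<mu> b * (F.cols ps ! c) (bs ! b)) = (\<Sum>b = 0..<K. \<mu> b * A $$ (\<pi> b, c))"
      using c K \<pi>m unfolding lo[OF c] by (intro sum.cong) (auto simp: bsn Arc)
    then show "(\<Sum>b = 0..<K. \<mu> b * (F.cols ps ! c) (bs ! b)) = (F.cols ps ! c) p"
      using \<mu>(2)[of c] c K lo[OF c] by simp
  qed
  moreover have "(\<Sum>b = 0..<K. \<mu> b *\<^sub>R bs ! b) \<in> convex hull (set bs)"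
  proof (rule convex_sum)
    have "(\<Sum>b = 0..<K. \<mu> b * A $$ (\<pi> b, 0)) = (\<Sum>b = 0..<K. \<mu> b)"
      using K \<pi>m by (intro sum.cong) (auto simp: Arc)
    then show "(\<Sum>b = 0..<K. \<mu> b) = 1" using \<mu>(2)[of 0] K by simp
  qed (use \<mu>(1) lbs in \<open>auto intro: hull_inc\<close>)
  ultimately have "p \<in> convex hull (set bs)" by simp
  moreover have "simplex_class s t F.G (set bs) = simplex_class s t P.G \<alpha>"
  proof -
    \<comment> \<open>The upper left block is the class matrix of these vertices inside the face, up
      to the choice of vertex and order.\<close>
    have "mat K K (\<lambda>(b, c). A $$ (\<pi> b, c)) = eval_mat bs (F.cols ps)"
      using lbs K \<pi>m by (intro eq_matI) (auto simp: eval_mat_def K_def[symmetric] bsn Arc lo simp del: nth_Cons_Suc)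
    then have "\<bar>Determinant.det (eval_mat bs (F.cols ps))\<bar> = \<bar>Determinant.det A\<bar>" using det by simp
    moreover have "simplex_class s t F.G (set bs) = \<bar>Determinant.det (eval_mat bs (F.cols ps))\<bar>"
      using D3 J_sub lbs KF by (intro F.simplex_class_eq[OF st _ v ps dbs bG]) blast+
    moreover have "simplex_class s t P.G (set as) = \<bar>Determinant.det A\<bar>"
      unfolding A_def using as \<alpha>G las mP by (intro P.simplex_class_eq[OF st D3 vP cs]) auto
    ultimately show ?thesis using as(1) by simp
  qed
  moreover have "card (set bs) = Suc (card (F.red v))" using distinct_card[OF dbs] lbs KF by simp
  ultimately show ?thesis using \<alpha> bsub bF by blast
qed

end

subsection \<open>Counting exterior faces\<close>

context simplex_product
begin

lemma finite_vertices: "finite (vertices G)"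
proof (rule finite_subset)
  let ?S = "Sigma {..<n} J"
  have fin: "finite ?S" using finite_J by auto
  show "finite ((\<lambda>S. mk_point S (\<lambda>_. 1)) ` Pow ?S)" using fin by simp
  show "vertices G \<subseteq> (\<lambda>S. mk_point S (\<lambda>_. 1)) ` Pow ?S"
  proof
    fix v assume v: "v \<in> vertices G"
    let ?T = "{q \<in> ?S. coord v q = 1}"
    have "v = mk_point ?T (\<lambda>_. 1)"
    proof (rule point_eqI)
      fix q :: "nat \<times> nat" obtain i j where q: "q = (i, j)" by (cases q)
      have "finite ?T" using fin by simp
      then show "coord v q = coord (mk_point ?T (\<lambda>_. 1)) q"
        using vertex_01(2)[OF v, of q] coord_zero[OF vertex_01(1)[OF v], of i j] q by auto
    qed
    then show "v \<in> (\<lambda>S. mk_point S (\<lambda>_. 1)) ` Pow ?S" by blast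
  qed
qed

lemma simplex_class_abs_det:
  assumes "n = s + t" "\<And>i. i < n \<Longrightarrow> J i \<subseteq> {..<3}" "v \<in> vertices G" "\<tau> \<subseteq> vertices G"
    "card \<tau> = Suc (card (red v))"
  obtains vs ps where "set vs = \<tau>" "distinct vs" "set ps = red v" "distinct ps"
    "length vs = Suc (length ps)" "length ps = card (red v)"
    "simplex_class s t G \<tau> = \<bar>Determinant.det (eval_mat vs (cols ps))\<bar>"
proof -
  have "finite \<tau>" using assms(5) card_ge_0_finite[of \<tau>] by simp
  then obtain vs where vs: "set vs = \<tau>" "distinct vs" using finite_distinct_list by blast
  obtain ps where ps: "set ps = red v" "distinct ps"
    using finite_distinct_list[OF finite_red] by blast
  have "\<tau> \<subseteq> G" using assms(4) vertex_01(1) by blast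
  have l: "length vs = Suc (card (red v))" "length ps = card (red v)"
    using vs ps distinct_card[OF vs(2)] distinct_card[OF ps(2)] assms(5) by auto
  have "simplex_class s t G (set vs) = \<bar>Determinant.det (eval_mat vs (cols ps))\<bar>"
    using vs l \<open>\<tau> \<subseteq> G\<close> by (intro simplex_class_eq[OF assms(1,2,3) ps]) auto
  then show ?thesis by (intro that[OF vs ps]) (use l vs in simp_all)
qed

lemma simplex_class_nat:
  assumes "n = s + t" "\<And>i. i < n \<Longrightarrow> J i \<subseteq> {..<3}" "v \<in> vertices G" "\<tau> \<subseteq> vertices G"
    "card \<tau> = Suc (card (red v))"
  obtains c :: nat where "simplex_class s t G \<tau> = real c"
proof -
  obtain vs ps where *: "set vs = \<tau>" "distinct vs" "set ps = red v" "distinct ps"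
    "length vs = Suc (length ps)" "length ps = card (red v)"
    "simplex_class s t G \<tau> = \<bar>Determinant.det (eval_mat vs (cols ps))\<bar>"
    by (rule simplex_class_abs_det[OF assms])
  obtain M where "Determinant.det (eval_mat vs (cols ps)) = of_int (Determinant.det M)"
  proof (rule det_cols_int)
    show "set vs \<subseteq> vertices G" "length vs = length (cols ps)" using * assms(4) by simp_all
  qed
  then have "simplex_class s t G \<tau> = real (nat \<bar>Determinant.det M\<bar>)" using * by simp
  then show ?thesis using that by blast
qed

lemma simplex_class_nonzero:
  assumes "n = s + t" "\<And>i. i < n \<Longrightarrow> J i \<subseteq> {..<3}" "v \<in> vertices G" "\<tau> \<subseteq> vertices G"
    "card \<tau> = Suc (card (red v))" "\<not> affine_dependent \<tau>"
  shows "simplex_class s t G \<tau> \<noteq> 0"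
proof -
  obtain vs ps where *: "set vs = \<tau>" "distinct vs" "set ps = red v" "distinct ps"
    "length vs = Suc (length ps)" "length ps = card (red v)"
    "simplex_class s t G \<tau> = \<bar>Determinant.det (eval_mat vs (cols ps))\<bar>"
    by (rule simplex_class_abs_det[OF assms(1-5)])
  have "\<tau> \<subseteq> G" using assms(4) vertex_01(1) by blast
  then show ?thesis using * assms(6) det_cols_nonzero[OF assms(3) *(3,4,2)] by simp
qed

lemma card_lattice_points_simplex_class_le:
  assumes "n = s + t" "\<And>i. i < n \<Longrightarrow> J i \<subseteq> {..<3}" "v \<in> vertices G" "\<tau> \<subseteq> vertices G"
    "card \<tau> = Suc (card (red v))" "simplex_class s t G \<tau> \<noteq> 0" "N > 0"
  defines "S \<equiv> {p \<in> convex hull \<tau>. \<forall>q. real N * coord p q \<in> \<int>}"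
  shows "finite S"
    "real (card S) \<le> simplex_class s t G \<tau> * real ((N + card (red v)) choose (card (red v)))"
proof -
  obtain vs ps where *: "set vs = \<tau>" "distinct vs" "set ps = red v" "distinct ps"
    "length vs = Suc (length ps)" "length ps = card (red v)"
    "simplex_class s t G \<tau> = \<bar>Determinant.det (eval_mat vs (cols ps))\<bar>"
    by (rule simplex_class_abs_det[OF assms(1-5)])
  have sub: "set vs \<subseteq> vertices G" and d: "Determinant.det (eval_mat vs (cols ps)) \<noteq> 0"
    using * assms(4,6) by auto
  note le = card_lattice_points_hull_le[OF *(2) sub _ *(6) d assms(7)]
  show "finite S"
    "real (card S) \<le> simplex_class s t G \<tau> * real ((N + card (red v)) choose (card (red v)))"
    unfolding S_def using le * by simp_all
qed

end

text \<open>Pairs are kept because the same \<open>\<tau>\<close> may be a face of several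
  simplices, each with its own class. The last condition says that \<open>\<tau>\<close> lies in no
  product face properly contained in \<open>G\<close>; through it \<open>\<tau>\<close> determines
  \<open>G\<close>.\<close>

definition matching_faces ::
    "nat \<Rightarrow> nat \<Rightarrow> point set set \<Rightarrow> nat \<Rightarrow> point set \<Rightarrow> (point set \<times> point set) set" where
  "matching_faces s t C k G = {(\<alpha>, \<tau>). \<alpha> \<in> C \<and> \<tau> \<subseteq> \<alpha> \<and> \<tau> \<subseteq> vertices G \<and> card \<tau> = Suc k \<and>
     simplex_class s t G \<tau> = simplex_class s t (simplotope s t) \<alpha> \<and>
     (\<forall>p. (\<exists>x\<in>G. coord x p \<noteq> 0) \<longrightarrow> (\<exists>x\<in>\<tau>. coord x p \<noteq> 0))}"

text \<open>Every interior lattice point lies in the hull of some matching \<open>\<tau>\<close>, so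
  the bounds for the single hulls add up to a bound for all points. Overlaps only enlarge the
  sum.\<close>

lemma (in simplex_product_face) card_interior_lattice_le:
  assumes st: "n = s + t" "simplotope s t = P.G" and D3: "\<And>i. i < n \<Longrightarrow> D i \<subseteq> {..<3}"
    and C: "finite C" "\<And>\<alpha>. \<alpha> \<in> C \<Longrightarrow> \<alpha> \<subseteq> vertices P.G"
      "\<And>\<alpha>. \<alpha> \<in> C \<Longrightarrow> card \<alpha> = Suc (card (P.red v))" "\<And>\<alpha>. \<alpha> \<in> C \<Longrightarrow> \<not> affine_dependent \<alpha>"
      "P.G \<subseteq> (\<Union>\<alpha>\<in>C. convex hull \<alpha>)"
    and v: "v \<in> vertices F.G" and k: "card (F.red v) = k" and N: "N > 0"
  defines "T \<equiv> matching_faces s t C k F.G"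
  shows "finite T" and "finite (F.interior_lattice N)"
    and "real (card (F.interior_lattice N))
       \<le> (\<Sum>(\<alpha>, \<tau>)\<in>T. simplex_class s t (simplotope s t) \<alpha>) * real ((N + k) choose k)"
proof -
  let ?S = "\<lambda>(\<alpha>, \<tau>). {p \<in> convex hull \<tau>. \<forall>q. real N * coord p q \<in> \<int>}"
  have vP: "v \<in> vertices P.G" using v vertices_face_sub by blast
  have J3: "J i \<subseteq> {..<3}" if "i < n" for i using J_sub D3 that by blast
  have "T \<subseteq> C \<times> Pow (vertices F.G)" unfolding T_def matching_faces_def by auto
  then show T: "finite T" using finite_subset C(1) F.finite_vertices by blast
  have S: "finite (?S a)" "real (card (?S a)) \<le> (case a of (\<alpha>, \<tau>) \<Rightarrow>
      simplex_class s t (simplotope s t) \<alpha>) * real ((N + k) choose k)" if a: "a \<in> T" for a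
  proof -
    obtain \<alpha> \<tau> where a': "a = (\<alpha>, \<tau>)" by (cases a)
    have *: "\<alpha> \<in> C" "\<tau> \<subseteq> vertices F.G" "card \<tau> = Suc (card (F.red v))"
      "simplex_class s t F.G \<tau> = simplex_class s t P.G \<alpha>"
      using a unfolding a' T_def matching_faces_def st(2) k by auto
    have nz: "simplex_class s t F.G \<tau> \<noteq> 0"
      unfolding *(4) by (rule P.simplex_class_nonzero[OF st(1) D3 vP C(2,3,4)[OF *(1)]])
    show "finite (?S a)" "real (card (?S a)) \<le> (case a of (\<alpha>, \<tau>) \<Rightarrow>
      simplex_class s t (simplotope s t) \<alpha>) * real ((N + k) choose k)"
      using F.card_lattice_points_simplex_class_le[OF st(1) J3 v *(2,3) nz N] *(4)
      unfolding a' st(2) k by auto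
  qed
  have sub: "F.interior_lattice N \<subseteq> (\<Union>a\<in>T. ?S a)"
  proof
    fix p assume "p \<in> F.interior_lattice N"
    then have p: "p \<in> F.G" "\<And>i j. i < n \<Longrightarrow> j \<in> J i \<Longrightarrow> 0 < coord p (i, j)" "\<forall>q. real N * coord p q \<in> \<int>"
      unfolding F.interior_lattice_def by auto
    obtain \<alpha> \<tau> where \<tau>: "\<alpha> \<in> C" "\<tau> \<subseteq> \<alpha>" "\<tau> \<subseteq> vertices F.G" "card \<tau> = Suc (card (F.red v))"
      "simplex_class s t F.G \<tau> = simplex_class s t P.G \<alpha>" "p \<in> convex hull \<tau>"
      using cover_restricts_to_face[OF st(1) D3 C v p(1,2)] by blast
    \<comment> \<open>A coordinate that vanishes on all of \<open>\<tau>\<close> vanishes at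
      \<open>p\<close>, but \<open>p\<close> is positive in every coordinate that does not vanish
      identically on the face.\<close>
    have "\<exists>x\<in>\<tau>. coord x q \<noteq> 0" if q: "\<exists>x\<in>F.G. coord x q \<noteq> 0" for q
    proof (rule ccontr)
      assume z: "\<not> (\<exists>x\<in>\<tau>. coord x q \<noteq> 0)"
      have "finite \<tau>" using \<tau>(3) F.finite_vertices finite_subset by blast
      then obtain u where "(\<Sum>x\<in>\<tau>. u x *\<^sub>R x) = p" using \<tau>(6) by (subst (asm) convex_hull_finite) auto
      then have "coord p q = (\<Sum>x\<in>\<tau>. u x * coord x q)" by (auto simp: lookup_sum)
      then have "coord p q = 0" using z by simp
      moreover have "0 < coord p q"
        using q F.nonvanishing_coord_iff[of "fst q" "snd q"] p(2)[of "fst q" "snd q"] by simp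
      ultimately show False by simp
    qed
    then have "(\<alpha>, \<tau>) \<in> T" unfolding T_def matching_faces_def using \<tau> k st(2) by (simp del: split_paired_All)
    then show "p \<in> (\<Union>a\<in>T. ?S a)" using \<tau>(6) p(3) by blast
  qed
  show "finite (F.interior_lattice N)" by (rule finite_subset[OF sub]) (use T S(1) in blast)
  have "card (F.interior_lattice N) \<le> card (\<Union>a\<in>T. ?S a)" using T S(1) by (intro card_mono[OF _ sub]) blast
  also have "\<dots> \<le> (\<Sum>a\<in>T. card (?S a))" by (rule card_UN_le[OF T])
  finally have "real (card (F.interior_lattice N)) \<le> (\<Sum>a\<in>T. real (card (?S a)))" by (simp flip: of_nat_sum)
  also have "\<dots> \<le> (\<Sum>a\<in>T. (case a of (\<alpha>, \<tau>) \<Rightarrow>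
      simplex_class s t (simplotope s t) \<alpha>) * real ((N + k) choose k))"
    using S(2) by (intro sum_mono) blast
  finally show "real (card (F.interior_lattice N))
       \<le> (\<Sum>(\<alpha>, \<tau>)\<in>T. simplex_class s t (simplotope s t) \<alpha>) * real ((N + k) choose k)"
    by (simp add: sum_distrib_right)
qed

text \<open>Leading coefficients are compared: the left side grows like N^k / 2^b, the right side
  like S * N^k / k!. Crude bounds by powers of N - 2 and N + k leave the k-th power of a single
  ratio, which tends to 1.\<close>

lemma fact_le_if_lattice_counts_le:
  fixes S :: real and a b :: nat
  defines "k \<equiv> a + 2 * b"
  assumes S: "0 \<le> S"
    and le: "\<And>N. N \<ge> 3 \<Longrightarrow> real ((N - 1) ^ a * ((N - 1) choose 2) ^ b) \<le> S * real ((N + k) choose k)"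
  shows "fact k / 2 ^ b \<le> S"
proof -
  have bound: "fact k / 2 ^ b * ((real N - 2) / (real N + real k)) ^ k \<le> S" if N: "N \<ge> 3" for N :: nat
  proof -
    have pos: "0 \<le> real N - 2" "0 < real N + real k" using N by auto
    have "(real N - 2) ^ 2 / 2 \<le> real ((N - 1) choose 2)"
    proof -
      have "2 * real ((N - 1) choose 2) = (real N - 1) * (real N - 2)"
        using N by (simp add: choose_two real_of_nat_div of_nat_diff)
      moreover have "(real N - 2) ^ 2 \<le> (real N - 1) * (real N - 2)"
        using N by (simp add: power2_eq_square mult_right_mono)
      ultimately show ?thesis by linarith
    qed
    then have "((real N - 2) ^ 2 / 2) ^ b \<le> real ((N - 1) choose 2) ^ b"
      by (rule power_mono) simp
    moreover have "(real N - 2) ^ a \<le> real (N - 1) ^ a"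
      using N by (intro power_mono) (auto simp: of_nat_diff)
    ultimately have "(real N - 2) ^ a * ((real N - 2) ^ 2 / 2) ^ b \<le> real (N - 1) ^ a * real ((N - 1) choose 2) ^ b"
      using pos by (intro mult_mono) auto
    also have "\<dots> \<le> S * real ((N + k) choose k)" using le[OF N] by simp
    also have "\<dots> \<le> S * ((real N + real k) ^ k / fact k)"
    proof (rule mult_left_mono[OF _ S])
      have "real (((N + k) choose k) * fact k) \<le> real ((N + k) ^ k)"
        using binomial_fact_pow of_nat_le_iff by blast
      then show "real ((N + k) choose k) \<le> (real N + real k) ^ k / fact k"
        by (simp add: field_simps)
    qed
    finally have "(real N - 2) ^ k / 2 ^ b \<le> S * ((real N + real k) ^ k / fact k)"
      unfolding k_def by (simp add: power_add power_mult power_divide)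
    then show ?thesis using pos by (simp add: power_divide field_simps)
  qed
  have "(\<lambda>N. (real N - 2) / (real N + real k)) \<longlonglongrightarrow> 1" by real_asymp
  then have "(\<lambda>N. fact k / 2 ^ b * ((real N - 2) / (real N + real k)) ^ k) \<longlonglongrightarrow> fact k / 2 ^ b * 1 ^ k"
    by (intro tendsto_intros)
  then have "fact k / 2 ^ b * 1 ^ k \<le> S"
    by (rule LIMSEQ_le_const2) (use bound in blast)
  then show ?thesis by simp
qed

lemma sum_card_minus_one:
  fixes n :: nat
  assumes "\<forall>i<n. card (J i) \<in> {1, 2, 3 :: nat}"
  shows "(\<Sum>i<n. card (J i) - 1) = card {i. i < n \<and> card (J i) = 2} + 2 * card {i. i < n \<and> card (J i) = 3}"
proof -
  have "(\<Sum>i<n. card (J i) - 1) = (\<Sum>i<n. (if card (J i) = 2 then 1 else 0) + (if card (J i) = 3 then 2 else 0))"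
    using assms by (intro sum.cong) auto
  also have "\<dots> = (\<Sum>i | i \<in> {..<n} \<and> card (J i) = 2. 1) + (\<Sum>i | i \<in> {..<n} \<and> card (J i) = 3. 2)"
    unfolding sum.distrib by (simp only: sum.inter_filter[OF finite_lessThan])
  finally show ?thesis by simp
qed

lemma prod_binomials:
  fixes n N :: nat
  assumes "\<forall>i<n. card (J i) \<in> {1, 2, 3 :: nat}" "N \<ge> 3"
  shows "(\<Prod>i<n. (N - 1) choose (N - card (J i))) =
    (N - 1) ^ card {i. i < n \<and> card (J i) = 2} * ((N - 1) choose 2) ^ card {i. i < n \<and> card (J i) = 3}"
proof -
  have "(\<Prod>i<n. (N - 1) choose (N - card (J i))) =
    (\<Prod>i<n. (if card (J i) = 2 then N - 1 else 1) * (if card (J i) = 3 then (N - 1) choose 2 else 1))"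
  proof (intro prod.cong refl)
    fix i assume i: "i \<in> {..<n}"
    then have d: "card (J i) = 1 \<or> card (J i) = 2 \<or> card (J i) = 3" using assms(1) by auto
    have "(N - 1) choose (N - card (J i)) = (N - 1) choose (card (J i) - 1)"
      using d assms(2) binomial_symmetric[of "card (J i) - 1" "N - 1"] by (auto simp: numeral_eq_Suc)
    then show "(N - 1) choose (N - card (J i)) =
        (if card (J i) = 2 then N - 1 else 1) * (if card (J i) = 3 then (N - 1) choose 2 else 1)"
      using d by auto
  qed
  also have "\<dots> = (\<Prod>i | i \<in> {..<n} \<and> card (J i) = 2. N - 1) * (\<Prod>i | i \<in> {..<n} \<and> card (J i) = 3. (N - 1) choose 2)"
    unfolding prod.distrib by (simp only: prod.inter_filter[OF finite_lessThan])
  finally show ?thesis by simp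
qed

section \<open>The simplotope and its product faces\<close>

definition full_coords :: "nat \<Rightarrow> nat \<Rightarrow> nat set" where
  "full_coords s i = {0..(if i < s then 1 else 2)}"

interpretation simplotope: simplex_product "s + t" "full_coords s" for s t
  by unfold_locales (auto simp: full_coords_def)

lemma simplotope_eq: "simplotope s t = simplotope.G s t"
  by (simp add: simplotope_def std_simplex_def full_coords_def)

lemma full_coords_lt_3: "full_coords s i \<subseteq> {..<3}"
  by (auto simp: full_coords_def split: if_splits)

lemma card_red_simplotope:
  assumes "v \<in> vertices (simplotope s t)" shows "card (simplotope.red s t v) = s + 2 * t"
proof -
  have "(\<Sum>i<s + t. card (full_coords s i) - 1) = s + 2 * t"
    by (induction t) (auto simp: full_coords_def)
  then show ?thesis using simplotope.card_red assms simplotope_eq by simp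
qed

text \<open>The class is an integer because vertices have coordinates 0 and 1, and nonzero because
  they are affinely independent. So the classes \<open>c >= 1\<close> account for every simplex of a
  cover.\<close>

lemma full_simplex_class:
  assumes "full_simplex s t \<alpha>"
  obtains c :: nat where "c \<ge> 1" "simplex_class s t (simplotope s t) \<alpha> = real c"
proof -
  obtain v where v: "v \<in> vertices (simplotope.G s t)" using simplotope.vertices_nonempty by blast
  have *: "\<alpha> \<subseteq> vertices (simplotope.G s t)" "card \<alpha> = Suc (card (simplotope.red s t v))" "\<not> affine_dependent \<alpha>"
    using assms v card_red_simplotope[of v s t] unfolding full_simplex_def simplotope_eq by auto
  obtain c :: nat where c: "simplex_class s t (simplotope s t) \<alpha> = real c"
    using simplotope.simplex_class_nat[OF refl full_coords_lt_3 v *(1,2)] unfolding simplotope_eq by blast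
  have "simplex_class s t (simplotope s t) \<alpha> \<noteq> 0"
    unfolding simplotope_eq by (rule simplotope.simplex_class_nonzero[OF refl full_coords_lt_3 v *])
  then show ?thesis using c that[of c] by (cases c) auto
qed

lemma finite_full_simplices: "finite {\<alpha>. full_simplex s t \<alpha>}"
  by (rule finite_subset[of _ "Pow (vertices (simplotope s t))"])
    (auto simp: full_simplex_def simplotope_eq simplotope.finite_vertices)

text \<open>\<open>Pi_face\<close> does not state that \<open>J i\<close> consists of coordinates of
  the simplotope. This follows from \<open>G\<close> being a face: for \<open>j\<close> in
  \<open>J i\<close> some vertex of \<open>G\<close> has coordinate 1 there, while coordinates
  outside \<open>full_coords\<close> vanish on the simplotope.\<close>

lemma Pi_face_elim:
  assumes "Pi_face s t s' t' G"
  obtains J where "simplex_product_face (s + t) J (full_coords s)"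
    "G = block_product (s + t) (\<lambda>i. coord_simplex (J i))" "\<forall>i<s + t. card (J i) \<in> {1, 2, 3}"
    "card {i. i < s + t \<and> card (J i) = 2} = s'" "card {i. i < s + t \<and> card (J i) = 3} = t'"
    "\<And>v. v \<in> vertices G \<Longrightarrow> card (simplex_product.red (s + t) J v) = s' + 2 * t'"
proof -
  obtain J where J: "G = block_product (s + t) (\<lambda>i. coord_simplex (J i))" "\<forall>i<s + t. card (J i) \<in> {1, 2, 3}"
    "card {i. i < s + t \<and> card (J i) = 2} = s'" "card {i. i < s + t \<and> card (J i) = 3} = t'"
    using assms unfolding Pi_face_def by blast
  have pos: "0 < card (J i)" if "i < s + t" for i using J(2) that by force
  interpret F: simplex_product "s + t" J
    by unfold_locales (use pos in \<open>auto simp: card_gt_0_iff\<close>)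
  have sub: "G \<subseteq> simplotope s t" using assms unfolding Pi_face_def by (simp add: face_of_def)
  have "J i \<subseteq> full_coords s i" if i: "i < s + t" for i
  proof
    fix j assume "j \<in> J i"
    then obtain v where "v \<in> vertices F.G" and v1: "coord v (i, j) = 1" using F.vertex_with_coord i by blast
    then have "v \<in> simplotope s t" using F.vertex_01(1) sub J(1) by blast
    then show "j \<in> full_coords s i"
      using v1 simplotope.coord_zero[of v s t i j] unfolding simplotope_eq by auto
  qed
  then have face: "simplex_product_face (s + t) J (full_coords s)" by unfold_locales
  have "card (F.red v) = s' + 2 * t'" if "v \<in> vertices G" for v
    using F.card_red[of v] that J sum_card_minus_one[OF J(2)] by simp
  then show ?thesis using face J by (intro that[of J]) auto
qed

text \<open>Supplies the face of the right dimension that \<open>exterior_face\<close> asks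
  for.\<close>

lemma Pi_face_dim_face:
  assumes "Pi_face s t s' t' G" shows "dim_face s t (s' + 2 * t') G"
proof -
  obtain J where J: "simplex_product_face (s + t) J (full_coords s)"
    "G = block_product (s + t) (\<lambda>i. coord_simplex (J i))"
    "\<And>v. v \<in> vertices G \<Longrightarrow> card (simplex_product.red (s + t) J v) = s' + 2 * t'"
    using Pi_face_elim[OF assms] by metis
  interpret simplex_product_face "s + t" J "full_coords s" by (rule J(1))
  obtain v where v: "v \<in> vertices F.G" using F.vertices_nonempty by blast
  have "affine_dimension G = s' + 2 * t'" using F.affine_dimension_G[OF v] J(2) J(3)[of v] v by simp
  moreover have "G \<noteq> {}" using F.vertex_01(1)[OF v] J(2) by auto
  ultimately show ?thesis using assms unfolding dim_face_def Pi_face_def by blast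
qed

text \<open>The coordinates that do not vanish identically on a product face recover its sets
  \<open>J i\<close>.\<close>

lemma Pi_face_eqI:
  assumes "Pi_face s t s' t' G" "Pi_face s t s' t' G'"
    and supp: "\<And>p. (\<exists>x\<in>G. coord x p \<noteq> 0) \<longleftrightarrow> (\<exists>x\<in>G'. coord x p \<noteq> 0)"
  shows "G = G'"
proof -
  obtain J where J: "simplex_product_face (s + t) J (full_coords s)"
    "G = block_product (s + t) (\<lambda>i. coord_simplex (J i))" using Pi_face_elim[OF assms(1)] by metis
  obtain J' where J': "simplex_product_face (s + t) J' (full_coords s)"
    "G' = block_product (s + t) (\<lambda>i. coord_simplex (J' i))" using Pi_face_elim[OF assms(2)] by metis
  interpret A: simplex_product_face "s + t" J "full_coords s" by (rule J(1))
  interpret B: simplex_product_face "s + t" J' "full_coords s" by (rule J'(1))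
  have "J i = J' i" if "i < s + t" for i
    using supp[of "(i, _)"] A.F.nonvanishing_coord_iff[of i] B.F.nonvanishing_coord_iff[of i] that
    unfolding J(2) J'(2) by blast
  then show ?thesis unfolding J(2) J'(2) block_product_def by auto
qed

text \<open>For every \<open>N >= 3\<close> the interior lattice points of \<open>G\<close> are
  bounded below by a product of binomials and above by the matching faces; growing \<open>N\<close>
  gives the constant.\<close>

lemma sum_matching_faces_ge:
  assumes cover: "is_cover s t C" and G: "Pi_face s t s' t' G"
  defines "T \<equiv> matching_faces s t C (s' + 2 * t') G"
  shows "finite T"
    and "fact (s' + 2 * t') / 2 ^ t' \<le> (\<Sum>(\<alpha>, \<tau>)\<in>T. simplex_class s t (simplotope s t) \<alpha>)"
proof -
  let ?k = "s' + 2 * t'"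
  obtain J where J: "simplex_product_face (s + t) J (full_coords s)"
    "G = block_product (s + t) (\<lambda>i. coord_simplex (J i))" "\<forall>i<s + t. card (J i) \<in> {1, 2, 3}"
    "card {i. i < s + t \<and> card (J i) = 2} = s'" "card {i. i < s + t \<and> card (J i) = 3} = t'"
    "\<And>v. v \<in> vertices G \<Longrightarrow> card (simplex_product.red (s + t) J v) = ?k"
    by (rule Pi_face_elim[OF G]) (rule that)
  interpret simplex_product_face "s + t" J "full_coords s" by (rule J(1))
  obtain v where v: "v \<in> vertices F.G" using F.vertices_nonempty by blast
  have vP: "v \<in> vertices (simplotope s t)" using v vertices_face_sub unfolding simplotope_eq by blast
  have full: "full_simplex s t \<alpha>" if "\<alpha> \<in> C" for \<alpha> using cover that unfolding is_cover_def by blast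
  have C: "finite C" "\<And>\<alpha>. \<alpha> \<in> C \<Longrightarrow> \<alpha> \<subseteq> vertices (simplotope.G s t)"
      "\<And>\<alpha>. \<alpha> \<in> C \<Longrightarrow> card \<alpha> = Suc (card (simplotope.red s t v))" "\<And>\<alpha>. \<alpha> \<in> C \<Longrightarrow> \<not> affine_dependent \<alpha>"
      "simplotope.G s t \<subseteq> (\<Union>\<alpha>\<in>C. convex hull \<alpha>)"
  proof -
    show "finite C" by (rule finite_subset[OF _ finite_full_simplices[of s t]]) (use full in blast)
    show "simplotope.G s t \<subseteq> (\<Union>\<alpha>\<in>C. convex hull \<alpha>)" using cover simplotope_eq unfolding is_cover_def by blast
  qed (use full card_red_simplotope[OF vP] simplotope_eq in \<open>auto simp: full_simplex_def\<close>)
  have k: "card (F.red v) = ?k" using J(6)[of v] v J(2) by simp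
  note bound = card_interior_lattice_le[OF refl simplotope_eq full_coords_lt_3 C v k, folded J(2), folded T_def]
  \<comment> \<open>\<open>T\<close> does not depend on the lattice, so any positive scale proves it
    finite.\<close>
  show "finite T" using bound(1)[of 1] by simp
  show "fact ?k / 2 ^ t' \<le> (\<Sum>(\<alpha>, \<tau>)\<in>T. simplex_class s t (simplotope s t) \<alpha>)"
  proof (rule fact_le_if_lattice_counts_le)
    show "0 \<le> (\<Sum>(\<alpha>, \<tau>)\<in>T. simplex_class s t (simplotope s t) \<alpha>)"
      by (intro sum_nonneg) (auto simp: simplex_class_def Let_def)
  next
    fix N :: nat assume N: "N \<ge> 3"
    have "(\<Prod>i<s + t. (N - 1) choose (N - card (J i))) \<le> card (F.interior_lattice N)"
    proof (rule F.card_interior_lattice_ge)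
      fix i assume "i < s + t"
      then have "card (J i) \<in> {1, 2, 3}" using J(3) by blast
      then show "card (J i) \<le> N" using N by auto
    qed (use N bound(2)[of N] in auto)
    then have "real ((N - 1) ^ s' * ((N - 1) choose 2) ^ t') \<le> real (card (F.interior_lattice N))"
      unfolding prod_binomials[OF J(3) N] J(4,5) by (simp only: of_nat_le_iff)
    also have "\<dots> \<le> (\<Sum>(\<alpha>, \<tau>)\<in>T. simplex_class s t (simplotope s t) \<alpha>) * real ((N + ?k) choose ?k)"
      using bound(3)[of N] N by simp
    finally show "real ((N - 1) ^ s' * ((N - 1) choose 2) ^ t')
      \<le> (\<Sum>(\<alpha>, \<tau>)\<in>T. simplex_class s t (simplotope s t) \<alpha>) * real ((N + ?k) choose ?k)" .
  qed
qed

text \<open>A supremum of naturals is an upper bound only if the set is bounded. It is, since there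
  are finitely many simplices on the vertices.\<close>

lemma exterior_count_le_F:
  assumes "full_simplex s t \<alpha>" "simplex_class s t (simplotope s t) \<alpha> = real c"
  shows "exterior_count s t s' t' c' \<alpha> \<le> F s t c s' t' c'"
  unfolding F_def
proof (rule cSup_upper)
  let ?X = "{exterior_count s t s' t' c' \<alpha> | \<alpha>. full_simplex s t \<alpha> \<and> simplex_class s t (simplotope s t) \<alpha> = real c}"
  have "?X \<subseteq> exterior_count s t s' t' c' ` {\<alpha>. full_simplex s t \<alpha>}" by blast
  then have "finite ?X" by (rule finite_subset) (simp add: finite_full_simplices)
  then show "bdd_above ?X" by (rule bdd_above_finite)
qed (use assms in blast)

text \<open>Ensures that the sum up to \<open>V s t\<close> misses no class occurring in the cover.
  Again finiteness of the set of simplices provides boundedness.\<close>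

lemma class_le_V:
  assumes "is_cover s t C" "\<alpha> \<in> C" "simplex_class s t (simplotope s t) \<alpha> = real c"
  shows "c \<le> V s t"
  unfolding V_def
proof (rule cSup_upper)
  let ?X = "{c. \<exists>C \<alpha>. is_cover s t C \<and> \<alpha> \<in> C \<and> simplex_class s t (simplotope s t) \<alpha> = real c}"
  have "?X \<subseteq> (\<lambda>\<alpha>. nat \<lfloor>simplex_class s t (simplotope s t) \<alpha>\<rfloor>) ` {\<alpha>. full_simplex s t \<alpha>}"
  proof
    fix c assume "c \<in> ?X"
    then obtain \<alpha> where "full_simplex s t \<alpha>" "simplex_class s t (simplotope s t) \<alpha> = real c"
      unfolding is_cover_def by blast
    then show "c \<in> (\<lambda>\<alpha>. nat \<lfloor>simplex_class s t (simplotope s t) \<alpha>\<rfloor>) ` {\<alpha>. full_simplex s t \<alpha>}"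
      by (intro image_eqI[of _ _ \<alpha>]) auto
  qed
  then have "finite ?X" by (rule finite_subset) (simp add: finite_full_simplices)
  then show "bdd_above ?X" by (rule bdd_above_finite)
qed (use assms in blast)

text \<open>A face from a matching pair is exterior and has the class \<open>c\<close> of
  \<open>\<alpha>\<close> itself, which is why \<open>c\<close> occurs twice among the arguments of
  \<open>F\<close>.\<close>

lemma card_matching_faces_le:
  assumes "full_simplex s t \<alpha>" and c: "simplex_class s t (simplotope s t) \<alpha> = real c"
  shows "card {\<tau>. \<exists>G. Pi_face s t s' t' G \<and> (\<alpha>, \<tau>) \<in> matching_faces s t C (s' + 2 * t') G}
    \<le> F s t c s' t' c"
proof -
  let ?E = "{\<tau>. exterior_face s t (s' + 2 * t') \<alpha> \<tau> \<and>
      (\<exists>G. Pi_face s t s' t' G \<and> \<tau> \<subseteq> G \<and> simplex_class s t G \<tau> = real c)}"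
  have "finite \<alpha>" using assms(1) card_ge_0_finite[of \<alpha>] by (simp add: full_simplex_def)
  moreover have "?E \<subseteq> Pow \<alpha>" by (auto simp: exterior_face_def)
  ultimately have "finite ?E" using finite_subset by blast
  moreover have "{\<tau>. \<exists>G. Pi_face s t s' t' G \<and> (\<alpha>, \<tau>) \<in> matching_faces s t C (s' + 2 * t') G} \<subseteq> ?E"
  proof clarify
    fix \<tau> G assume G: "Pi_face s t s' t' G" and m: "(\<alpha>, \<tau>) \<in> matching_faces s t C (s' + 2 * t') G"
    have "vertices G \<subseteq> G" by (auto simp: vertices_def extreme_point_of_def)
    then have "\<tau> \<subseteq> G" using m unfolding matching_faces_def by blast
    then show "exterior_face s t (s' + 2 * t') \<alpha> \<tau> \<and>
      (\<exists>G. Pi_face s t s' t' G \<and> \<tau> \<subseteq> G \<and> simplex_class s t G \<tau> = real c)"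
      using m G Pi_face_dim_face[OF G] c unfolding exterior_face_def matching_faces_def by auto
  qed
  ultimately have "card {\<tau>. \<exists>G. Pi_face s t s' t' G \<and> (\<alpha>, \<tau>) \<in> matching_faces s t C (s' + 2 * t') G}
      \<le> exterior_count s t s' t' c \<alpha>"
    unfolding exterior_count_def by (rule card_mono)
  then show ?thesis using exterior_count_le_F[OF assms] le_trans by blast
qed

theorem theorem6:
  fixes s t s' t' :: nat and C :: "point set set"
  assumes "is_cover s t C"
    and "t' \<le> t"
    and "s' \<le> s + t - t'"
  shows "(\<Sum>c = 1..V s t. real c * real (num_of_class s t C c) / fact (s' + 2 * t')
            * real (F s t c s' t' c)) \<ge> real (Q s t s' t') / 2 ^ t'"
proof (cases "finite {G. Pi_face s t s' t' G}")
  \<comment> \<open>\<open>card\<close> of an infinite set is 0, so the right side vanishes here and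
    the faces need not be shown to be finite in number.\<close>
  case False
  then have "Q s t s' t' = 0" by (simp add: Q_def)
  then show ?thesis by (auto intro!: sum_nonneg)
next
  case True
  let ?k = "s' + 2 * t'"
  let ?cls = "simplex_class s t (simplotope s t)"
  let ?T = "matching_faces s t C ?k" and ?Faces = "{G. Pi_face s t s' t' G}"
  define E where "E \<alpha> = {\<tau>. \<exists>G. Pi_face s t s' t' G \<and> (\<alpha>, \<tau>) \<in> ?T G}" for \<alpha>
  define m where "m \<alpha> = nat \<lfloor>?cls \<alpha>\<rfloor>" for \<alpha>
  have full: "full_simplex s t \<alpha>" if "\<alpha> \<in> C" for \<alpha> using assms(1) that unfolding is_cover_def by blast
  have finC: "finite C" by (rule finite_subset[OF _ finite_full_simplices[of s t]]) (use full in blast)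
  have m: "?cls \<alpha> = real (m \<alpha>)" "1 \<le> m \<alpha>" "m \<alpha> \<le> V s t" if \<alpha>: "\<alpha> \<in> C" for \<alpha>
  proof -
    obtain c :: nat where "c \<ge> 1" "?cls \<alpha> = real c" using full_simplex_class[OF full[OF \<alpha>]] by blast
    then show "?cls \<alpha> = real (m \<alpha>)" "1 \<le> m \<alpha>" "m \<alpha> \<le> V s t"
      using class_le_V[OF assms(1) \<alpha>] by (auto simp: m_def)
  qed
  have finE: "finite (E \<alpha>)" if "\<alpha> \<in> C" for \<alpha>
  proof (rule finite_subset)
    show "E \<alpha> \<subseteq> Pow \<alpha>" by (auto simp: E_def matching_faces_def)
    show "finite (Pow \<alpha>)" using full[OF that] card_ge_0_finite[of \<alpha>] by (simp add: full_simplex_def)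
  qed
  have "real (Q s t s' t') * (fact ?k / 2 ^ t') = (\<Sum>G\<in>?Faces. fact ?k / 2 ^ t')"
    by (simp add: Q_def)
  also have "\<dots> \<le> (\<Sum>G\<in>?Faces. \<Sum>(\<alpha>, \<tau>)\<in>?T G. ?cls \<alpha>)"
    using sum_matching_faces_ge(2)[OF assms(1)] by (intro sum_mono) blast
  also have "\<dots> = (\<Sum>(\<alpha>, \<tau>)\<in>(\<Union>G\<in>?Faces. ?T G). ?cls \<alpha>)"
  proof (rule sum.UNION_disjoint[symmetric, OF True])
    show "\<forall>G\<in>?Faces. finite (?T G)" using sum_matching_faces_ge(1)[OF assms(1)] by blast
    \<comment> \<open>For a common pair, \<open>\<tau>\<close> lies in both faces and touches every
      coordinate not vanishing on either, so the same coordinates vanish on both faces.\<close>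
    show "\<forall>G\<in>?Faces. \<forall>G'\<in>?Faces. G \<noteq> G' \<longrightarrow> ?T G \<inter> ?T G' = {}"
    proof (intro ballI impI, rule ccontr)
      fix G G' assume G: "G \<in> ?Faces" "G' \<in> ?Faces" "G \<noteq> G'" and "?T G \<inter> ?T G' \<noteq> {}"
      then obtain \<alpha> \<tau> where *: "(\<alpha>, \<tau>) \<in> ?T G" "(\<alpha>, \<tau>) \<in> ?T G'" by auto
      have "vertices G \<subseteq> G" "vertices G' \<subseteq> G'" by (auto simp: vertices_def extreme_point_of_def)
      then have "\<tau> \<subseteq> G" "\<tau> \<subseteq> G'" using * unfolding matching_faces_def by blast+
      then have "(\<exists>x\<in>G. coord x p \<noteq> 0) \<longleftrightarrow> (\<exists>x\<in>G'. coord x p \<noteq> 0)" for p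
        using * unfolding matching_faces_def by blast
      then show False using Pi_face_eqI[of s t s' t' G G'] G by blast
    qed
  qed
  \<comment> \<open>The same pairs are regrouped by simplex: \<open>E \<alpha>\<close> collects the
    matching faces of \<open>\<alpha>\<close> over all \<open>G\<close>.\<close>
  also have "(\<Union>G\<in>?Faces. ?T G) = (SIGMA \<alpha>:C. E \<alpha>)"
    by (auto simp: E_def matching_faces_def)
  also have "(\<Sum>(\<alpha>, \<tau>)\<in>(SIGMA \<alpha>:C. E \<alpha>). ?cls \<alpha>) = (\<Sum>\<alpha>\<in>C. real (card (E \<alpha>)) * ?cls \<alpha>)"
    using finC finE by (subst sum.Sigma[symmetric]) auto
  also have "\<dots> \<le> (\<Sum>\<alpha>\<in>C. real (F s t (m \<alpha>) s' t' (m \<alpha>)) * real (m \<alpha>))"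
    using card_matching_faces_le[OF full m(1)] m(1) unfolding E_def
    by (intro sum_mono) (simp add: mult_right_mono)
  also have "\<dots> = (\<Sum>c = 1..V s t. \<Sum>\<alpha> | \<alpha> \<in> C \<and> m \<alpha> = c. real (F s t (m \<alpha>) s' t' (m \<alpha>)) * real (m \<alpha>))"
    using m by (intro sum.group[symmetric] finC) auto
  also have "\<dots> = (\<Sum>c = 1..V s t. real c * real (num_of_class s t C c) * real (F s t c s' t' c))"
  proof (intro sum.cong refl)
    fix c
    have "{\<alpha> \<in> C. m \<alpha> = c} = {\<alpha> \<in> C. ?cls \<alpha> = real c}" using m(1) by auto
    then have "num_of_class s t C c = card {\<alpha> \<in> C. m \<alpha> = c}" by (simp add: num_of_class_def)
    moreover have "(\<Sum>\<alpha> | \<alpha> \<in> C \<and> m \<alpha> = c. real (F s t (m \<alpha>) s' t' (m \<alpha>)) * real (m \<alpha>)) =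
      (\<Sum>\<alpha> | \<alpha> \<in> C \<and> m \<alpha> = c. real (F s t c s' t' c) * real c)" by (intro sum.cong) auto
    ultimately show "(\<Sum>\<alpha> | \<alpha> \<in> C \<and> m \<alpha> = c. real (F s t (m \<alpha>) s' t' (m \<alpha>)) * real (m \<alpha>)) =
      real c * real (num_of_class s t C c) * real (F s t c s' t' c)" by simp
  qed
  finally have "real (Q s t s' t') * (fact ?k / 2 ^ t') / fact ?k
      \<le> (\<Sum>c = 1..V s t. real c * real (num_of_class s t C c) * real (F s t c s' t' c)) / fact ?k"
    by (intro divide_right_mono) auto
  then show ?thesis by (simp add: sum_divide_distrib)
qed

end
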